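(* Let $K$ be a field and let $I$ be a matroidal ideal of degree $d$ of the polynomial ring $R=K[x_1,\dots,x_n]$ with $\mathrm{supp}(I)=\{x_1,\dots,x_n\}$, where $n\ge 2$. Suppose that $I$ is unmixed, and let $h$ be the height of $I$. Then $h+d-1\le n\le hd$. In particular, $n=h+d-1$ if and only if $I$ is square-free Veronese; and $n=hd$ if and only if $I=J_1*J_2*\cdots*J_d$, where each $J_i$ is generated by $h$ distinct variables.
   Context: $R=K[x_1,\dots,x_n]$ is the polynomial ring in $n$ variables over a field $K$. For a monomial $u=x_1^{a_1}\cdots x_n^{a_n}$, $\mathrm{supp}(u)=\{x_i : a_i\neq 0\}$. For a monomial ideal $I$, $G(I)$ is its unique minimal set of monomial generators and $\mathrm{supp}(I)=\bigcup_{u\in G(I)}\mathrm{supp}(u)$. A monomial ideal $I$ is matroidal if every member of $G(I)$ is square-free and the following exchange condition holds: for any $u=x_1^{a_1}\cdots x_n^{a_n}$, $v=x_1^{b_1}\cdots x_n^{b_n}$ in $G(I)$, if $a_i>b_i$ for some $i$, then there is some $j$ with $a_j<b_j$ such that $x_ju/x_i\in G(I)$. All elements of $G(I)$ then have the same degree $d$, called the degree of $I$. An ideal is unmixed if all its prime divisors (associated primes) have the same height. The square-free Veronese ideal of degree $d$ in the variables $\{x_1,\dots,x_n\}$ is the ideal generated by all square-free monomials of degree $d$ in these variables; "$I$ is square-free Veronese" means that $I$ is this ideal. For monomial ideals $J_1,\dots,J_d$ whose supports are pairwise disjoint, $J_1*\cdots*J_d$ denotes their product, i.e. the ideal generated by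 all products $u_1\cdots u_d$ with $u_i\in G(J_i)$. *)

theory Defs
  imports
    "HOL-Library.Poly_Mapping"
    "HOL-Library.Extended_Nat"
    "HOL-Library.Disjoint_Sets"
    "HOL-Library.Cardinality"
    "HOL-Algebra.Algebraic_Closure_Type"
begin

section \<open>Height, associated primes and unmixedness\<close>

text \<open>The supremum of the lengths \<open>m\<close> of chains \<open>C 0 \<subset> \<dots> \<subset> C m = P\<close> of prime ideals.\<close>

definition prime_height :: "('a, 'b) ring_scheme \<Rightarrow> 'a set \<Rightarrow> enat" where
  "prime_height R P =
     (SUP m \<in> {m. \<exists>C. (\<forall>i\<le>m. primeideal (C i) R) \<and> (\<forall>i<m. C i \<subset> C (Suc i)) \<and> C m = P}. enat m)"

definition ideal_height :: "('a, 'b) ring_scheme \<Rightarrow> 'a set \<Rightarrow> enat" where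
  "ideal_height R I = (INF P \<in> {P. primeideal P R \<and> I \<subseteq> P}. prime_height R P)"

text \<open>The prime divisors of \<open>I\<close>, i.e. the associated primes of the module \<open>R/I\<close>: the prime ideals
  of the form \<open>I : f\<close>, which is the annihilator of the class of \<open>f\<close> in \<open>R/I\<close>.\<close>

definition associated_primes :: "('a, 'b) ring_scheme \<Rightarrow> 'a set \<Rightarrow> 'a set set" where
  "associated_primes R I =
     {P. primeideal P R \<and> (\<exists>f\<in>carrier R. P = {r \<in> carrier R. r \<otimes>\<^bsub>R\<^esub> f \<in> I})}"

definition unmixed :: "('a, 'b) ring_scheme \<Rightarrow> 'a set \<Rightarrow> bool" where
  "unmixed R I \<longleftrightarrow>
     (\<forall>P\<in>associated_primes R I. \<forall>Q\<in>associated_primes R I. prime_height R P = prime_height R Q)"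


section \<open>Monomial ideals in a polynomial ring\<close>

text \<open>A monomial in the variables \<open>'x\<close> is represented by its exponent vector, of type \<open>'x \<Rightarrow>\<^sub>0 nat\<close>,
  and the polynomial ring over \<open>'k\<close> is the monoid algebra on these vectors. For a finite type
  \<open>'x\<close> it is the polynomial ring in \<open>CARD('x)\<close> variables.\<close>

type_synonym ('x, 'k) mpoly = "('x \<Rightarrow>\<^sub>0 nat) \<Rightarrow>\<^sub>0 'k"

abbreviation polynomial_ring :: "('x, 'k::field) mpoly ring" where
  "polynomial_ring \<equiv> ring_of_type_algebra"

definition monomial :: "('x \<Rightarrow>\<^sub>0 nat) \<Rightarrow> ('x, 'k::field) mpoly" where
  "monomial u = Poly_Mapping.single u 1"

definition variable :: "'x \<Rightarrow> ('x, 'k::field) mpoly" where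
  "variable x = monomial (Poly_Mapping.single x 1)"

definition monomial_degree :: "('x \<Rightarrow>\<^sub>0 nat) \<Rightarrow> nat" where
  "monomial_degree u = (\<Sum>x\<in>Poly_Mapping.keys u. Poly_Mapping.lookup u x)"

definition square_free :: "('x \<Rightarrow>\<^sub>0 nat) \<Rightarrow> bool" where
  "square_free u \<longleftrightarrow> (\<forall>x. Poly_Mapping.lookup u x \<le> 1)"

definition ideal_of_monomials :: "('x \<Rightarrow>\<^sub>0 nat) set \<Rightarrow> ('x, 'k::field) mpoly set" where
  "ideal_of_monomials M = genideal polynomial_ring (monomial ` M)"

definition monomial_ideal :: "('x, 'k::field) mpoly set \<Rightarrow> bool" where
  "monomial_ideal I \<longleftrightarrow> (\<exists>M. I = ideal_of_monomials M)"

definition is_min_gens :: "('x \<Rightarrow>\<^sub>0 nat) set \<Rightarrow> ('x, 'k::field) mpoly set \<Rightarrow> bool" where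
  "is_min_gens G I \<longleftrightarrow> ideal_of_monomials G = I \<and> (\<forall>H. H \<subset> G \<longrightarrow> ideal_of_monomials H \<noteq> I)"

text \<open>\<open>G(I)\<close>; it is well defined for every monomial ideal by \<open>ex1_min_gens\<close> below.\<close>

definition min_gens :: "('x, 'k::field) mpoly set \<Rightarrow> ('x \<Rightarrow>\<^sub>0 nat) set" where
  "min_gens I = (THE G. is_min_gens G I)"

definition ideal_support :: "('x, 'k::field) mpoly set \<Rightarrow> 'x set" where
  "ideal_support I = (\<Union>u\<in>min_gens I. Poly_Mapping.keys u)"

text \<open>In the exchange condition, \<open>u + Poly_Mapping.single j 1 - Poly_Mapping.single i 1\<close> is the
  exponent vector of \<open>x\<^sub>j u / x\<^sub>i\<close>; the subtraction does not truncate, as \<open>x\<^sub>i\<close> divides \<open>u\<close>.\<close>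

definition matroidal :: "('x, 'k::field) mpoly set \<Rightarrow> bool" where
  "matroidal I \<longleftrightarrow> monomial_ideal I \<and>
     (\<forall>u\<in>min_gens I. square_free u) \<and>
     (\<forall>u\<in>min_gens I. \<forall>v\<in>min_gens I. \<forall>i. Poly_Mapping.lookup u i > Poly_Mapping.lookup v i \<longrightarrow>
        (\<exists>j. Poly_Mapping.lookup u j < Poly_Mapping.lookup v j \<and>
             u + Poly_Mapping.single j 1 - Poly_Mapping.single i 1 \<in> min_gens I))"

definition matroidal_of_degree :: "nat \<Rightarrow> ('x, 'k::field) mpoly set \<Rightarrow> bool" where
  "matroidal_of_degree d I \<longleftrightarrow> matroidal I \<and> (\<forall>u\<in>min_gens I. monomial_degree u = d)"

definition square_free_veronese :: "nat \<Rightarrow> ('x, 'k::field) mpoly set" where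
  "square_free_veronese d = ideal_of_monomials {u. square_free u \<and> monomial_degree u = d}"

text \<open>The product of the monomial ideals \<open>J i\<close> for \<open>i \<in> A\<close>, meant for ideals with pairwise disjoint
  supports.\<close>

definition monomial_ideal_product :: "nat set \<Rightarrow> (nat \<Rightarrow> ('x, 'k::field) mpoly set) \<Rightarrow> ('x, 'k) mpoly set"
  where "monomial_ideal_product A J =
    genideal polynomial_ring {\<Prod>i\<in>A. monomial (u i) | u. \<forall>i\<in>A. u i \<in> min_gens (J i)}"


section \<open>Uniqueness of the minimal monomial generators\<close>

lemma polynomial_ring_simps:
  "carrier (ring_of_type_algebra :: 'a::comm_ring_1 ring) = UNIV"
  "x \<otimes>\<^bsub>ring_of_type_algebra\<^esub> y = (x * y :: 'a::comm_ring_1)"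
  "x \<oplus>\<^bsub>ring_of_type_algebra\<^esub> y = (x + y :: 'a::comm_ring_1)"
  "\<one>\<^bsub>ring_of_type_algebra\<^esub> = (1 :: 'a::comm_ring_1)"
  "\<zero>\<^bsub>ring_of_type_algebra\<^esub> = (0 :: 'a::comm_ring_1)"
  by (simp_all add: ring_of_type_algebra_def)

lemma ideal_polynomial_ringI:
  fixes S :: "'a::comm_ring_1 set"
  assumes "0 \<in> S" "\<And>x y. x \<in> S \<Longrightarrow> y \<in> S \<Longrightarrow> x + y \<in> S" "\<And>x r. x \<in> S \<Longrightarrow> r * x \<in> S"
  shows "ideal S ring_of_type_algebra"
proof -
  interpret R: cring "ring_of_type_algebra :: 'a ring" by (rule cring_from_type_algebra)
  have minus: "\<ominus>\<^bsub>ring_of_type_algebra\<^esub> x = - x" for x :: 'a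
    using R.minus_equality[of "- x" x] by (simp add: polynomial_ring_simps)
  have neg: "- x \<in> S" if "x \<in> S" for x
    using assms(3)[OF that, of "- 1"] by simp
  show ?thesis
  proof (rule idealI)
    show "subgroup S (add_monoid ring_of_type_algebra)"
    proof (rule R.add.subgroupI)
      show "S \<noteq> {}" using assms(1) by auto
    qed (use assms neg in \<open>auto simp: polynomial_ring_simps minus minus[unfolded a_inv_def]\<close>)
    show "r \<otimes>\<^bsub>ring_of_type_algebra\<^esub> x \<in> S" if "x \<in> S" for x r
      using assms(3)[OF that] by (simp add: polynomial_ring_simps)
    show "x \<otimes>\<^bsub>ring_of_type_algebra\<^esub> r \<in> S" if "x \<in> S" for x r
      using assms(3)[OF that] by (simp add: polynomial_ring_simps mult.commute)
  qed (rule R.ring_axioms)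
qed

lemma monomial_mult: "monomial u * monomial v = monomial (u + v)"
  by (simp add: monomial_def mult_single)

lemma ideal_ideal_of_monomials:
  "ideal (ideal_of_monomials M :: ('x, 'k::field) mpoly set) polynomial_ring"
proof -
  interpret R: cring "polynomial_ring :: ('x, 'k) mpoly ring" by (rule cring_from_type_algebra)
  show ?thesis
    unfolding ideal_of_monomials_def by (rule R.genideal_ideal) (simp add: polynomial_ring_simps)
qed

lemma monomial_in_ideal_of_monomials: "u \<in> M \<Longrightarrow> monomial u \<in> ideal_of_monomials M"
  by (auto simp: ideal_of_monomials_def genideal_def)

lemma ideal_of_monomials_minimal:
  assumes "ideal I polynomial_ring" "monomial ` M \<subseteq> I"
  shows "ideal_of_monomials M \<subseteq> I"
  using assms by (auto simp: ideal_of_monomials_def genideal_def)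

lemma keys_ideal_of_monomials:
  fixes p :: "('x, 'k::field) mpoly"
  assumes "p \<in> ideal_of_monomials M" "w \<in> Poly_Mapping.keys p"
  shows "\<exists>u\<in>M. \<exists>v. w = u + v"
proof -
  let ?S = "{p :: ('x, 'k) mpoly. \<forall>w\<in>Poly_Mapping.keys p. \<exists>u\<in>M. \<exists>v. w = u + v}"
  have "ideal ?S polynomial_ring"
  proof (rule ideal_polynomial_ringI)
    fix p q assume "p \<in> ?S" "q \<in> ?S"
    thus "p + q \<in> ?S"
      using Poly_Mapping.keys_add[of p q] by blast
  next
    fix p r assume p: "p \<in> ?S"
    show "r * p \<in> ?S"
    proof (clarify)
      fix w assume "w \<in> Poly_Mapping.keys (r * p)"
      with keys_mult[of r p] obtain a b
        where ab: "w = a + b" "b \<in> Poly_Mapping.keys p" by blast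
      with p obtain u v where "u \<in> M" "b = u + v" by blast
      with ab show "\<exists>u\<in>M. \<exists>v. w = u + v"
        by (intro bexI[of _ u] exI[of _ "a + v"]) (auto simp: ac_simps)
    qed
  qed simp
  moreover have "monomial ` M \<subseteq> ?S"
    by (auto simp: monomial_def intro!: exI[of _ 0])
  ultimately show ?thesis
    using ideal_of_monomials_minimal assms by blast
qed

lemma monomial_in_ideal_of_monomials_iff:
  "(monomial w :: ('x, 'k::field) mpoly) \<in> ideal_of_monomials M \<longleftrightarrow> (\<exists>u\<in>M. \<exists>v. w = u + v)"
proof
  assume "(monomial w :: ('x, 'k) mpoly) \<in> ideal_of_monomials M"
  from keys_ideal_of_monomials[OF this] show "\<exists>u\<in>M. \<exists>v. w = u + v"
    by (auto simp: monomial_def)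
next
  interpret J: ideal "ideal_of_monomials M :: ('x, 'k) mpoly set" polynomial_ring
    by (rule ideal_ideal_of_monomials)
  assume "\<exists>u\<in>M. \<exists>v. w = u + v"
  then obtain u v where "u \<in> M" "w = u + v" by blast
  thus "(monomial w :: ('x, 'k) mpoly) \<in> ideal_of_monomials M"
    using J.I_r_closed[OF monomial_in_ideal_of_monomials, of u "monomial v"]
    by (simp add: polynomial_ring_simps monomial_mult)
qed

lemma monomial_degree_plus: "monomial_degree (u + v) = monomial_degree u + monomial_degree v"
proof -
  let ?A = "Poly_Mapping.keys u \<union> Poly_Mapping.keys v"
  have eq: "monomial_degree w = (\<Sum>x\<in>?A. Poly_Mapping.lookup w x)"
    if "Poly_Mapping.keys w \<subseteq> ?A" for w
    unfolding monomial_degree_def using that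
    by (intro sum.mono_neutral_left) (auto simp: in_keys_iff)
  show ?thesis
    by (subst (1 2 3) eq) (use Poly_Mapping.keys_add[of u v] in \<open>auto simp: lookup_add sum.distrib\<close>)
qed

lemma monomial_degree_0_iff: "monomial_degree u = 0 \<longleftrightarrow> u = 0"
  by (auto simp: monomial_degree_def in_keys_iff intro: poly_mapping_eqI)

lemma is_min_gens_iff:
  fixes I :: "('x, 'k::field) mpoly set"
  assumes "monomial_ideal I"
  shows "is_min_gens G I \<longleftrightarrow>
    G = {u. monomial u \<in> I \<and> (\<forall>v w. u = v + w \<and> monomial v \<in> I \<longrightarrow> v = u)}"
    (is "_ \<longleftrightarrow> G = ?D")
proof -
  have ideal: "ideal I polynomial_ring"
    using assms ideal_ideal_of_monomials by (auto simp: monomial_ideal_def)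
  have factor: "\<exists>v\<in>?D. \<exists>w. u = v + w" if "monomial u \<in> I" for u
    using that
  proof (induction "monomial_degree u" arbitrary: u rule: less_induct)
    case less
    show ?case
    proof (cases "u \<in> ?D")
      case True
      thus ?thesis by (intro bexI[of _ u] exI[of _ 0]) auto
    next
      case False
      with less.prems obtain v w where vw: "u = v + w" "monomial v \<in> I" "v \<noteq> u" by blast
      hence "w \<noteq> 0" by auto
      hence "monomial_degree v < monomial_degree u"
        using monomial_degree_0_iff[of w] by (simp add: vw(1) monomial_degree_plus)
      from less.hyps[OF this vw(2)] obtain v' w' where "v' \<in> ?D" "v = v' + w'" by blast
      thus ?thesis
        by (intro bexI[of _ v'] exI[of _ "w' + w"]) (auto simp: vw(1) ac_simps)
    qed
  qed
  have sub: "?D \<subseteq> H" if H: "ideal_of_monomials H = I" for H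
  proof
    fix u assume u: "u \<in> ?D"
    hence "(monomial u :: ('x, 'k) mpoly) \<in> ideal_of_monomials H" by (simp add: H)
    then obtain v w where vw: "v \<in> H" "u = v + w"
      by (auto simp: monomial_in_ideal_of_monomials_iff)
    have "(monomial v :: ('x, 'k) mpoly) \<in> ideal_of_monomials H"
      using vw(1) by (rule monomial_in_ideal_of_monomials)
    hence "monomial v \<in> I" by (simp add: H)
    moreover have "\<forall>v w. u = v + w \<and> monomial v \<in> I \<longrightarrow> v = u"
      using u unfolding mem_Collect_eq by (rule conjunct2)
    ultimately have "v = u" using vw(2) by iprover
    thus "u \<in> H" using vw(1) by (rule subst)
  qed
  have gen: "ideal_of_monomials ?D = I"
  proof
    show "ideal_of_monomials ?D \<subseteq> I"
      using ideal by (intro ideal_of_monomials_minimal) auto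
    obtain M where M: "I = ideal_of_monomials M"
      using assms by (auto simp: monomial_ideal_def)
    have "monomial ` M \<subseteq> (ideal_of_monomials ?D :: ('x, 'k) mpoly set)"
    proof clarify
      fix u assume "u \<in> M"
      hence "monomial u \<in> I" by (simp add: M monomial_in_ideal_of_monomials)
      from factor[OF this] show "(monomial u :: ('x, 'k) mpoly) \<in> ideal_of_monomials ?D"
        unfolding monomial_in_ideal_of_monomials_iff .
    qed
    with ideal_of_monomials_minimal[OF ideal_ideal_of_monomials]
    show "I \<subseteq> ideal_of_monomials ?D" unfolding M by blast
  qed
  show ?thesis
  proof
    assume "is_min_gens G I"
    hence G: "ideal_of_monomials G = I" "\<And>H. H \<subset> G \<Longrightarrow> ideal_of_monomials H \<noteq> I"
      unfolding is_min_gens_def by blast+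
    from G(2)[of ?D] gen sub[OF G(1)] show "G = ?D"
      unfolding psubset_eq by metis
  next
    assume G: "G = ?D"
    show "is_min_gens G I"
      unfolding is_min_gens_def G
    proof (intro conjI allI impI notI)
      fix H assume "H \<subset> ?D" "ideal_of_monomials H = I"
      from sub[OF this(2)] this(1) show False by (meson leD)
    qed (rule gen)
  qed
qed

lemma ex1_min_gens: "monomial_ideal I \<Longrightarrow> \<exists>!G. is_min_gens G I"
  by (simp add: is_min_gens_iff)

end

theory Submission
  imports Defs
begin

text \<open>The minimal generators of a matroidal ideal \<open>I\<close> of degree \<open>d\<close> are the square-free monomials whose
  supports are the bases of a matroid of rank \<open>d\<close> on the variables, and this matroid has no loops
  because every variable occurs. The proof first turns the two algebraic hypotheses, unmixedness and
  height \<open>h\<close>, into one statement about this matroid: \<^emph>\<open>every cocircuit has exactly \<open>h\<close> elements\<close>,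
  a cocircuit being a minimal set of variables that meets every basis.

  A prime ideal over \<open>I\<close> contains a variable from each basis, hence contains the ideal \<open>P\<^sub>C\<close> generated
  by the variables of some cocircuit \<open>C\<close> (\<open>prime_contains_minimal_cover\<close>). Conversely every \<open>P\<^sub>C\<close> is a
  colon ideal of \<open>I\<close> by a monomial, so it is associated (\<open>minimal_cover_associated_prime\<close>). Since
  \<open>P\<^sub>C\<close> has height \<open>card C\<close> (\<open>prime_height_variable_ideal\<close>), the translation follows in
  \<open>unmixed_minimal_covers\<close>. The height rests on the bound \<open>dim K[x\<^sub>1, \<dots>, x\<^sub>n] \<le> n\<close>
  (\<open>prime_chain_length_le\<close>), which is obtained by linear algebra: more than \<open>n\<close> polynomials are
  algebraically dependent, and a dependence between elements that separate successive members of a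
  chain of primes would put a nonzero constant into the last prime.

  The rest is combinatorics. Let \<open>B\<close> be a basis and, for \<open>b \<in> B\<close>, let \<open>C\<^sub>b\<close> be its fundamental
  cocircuit, the set of all \<open>x\<close> such that \<open>B - b + x\<close> is a basis. It meets \<open>B\<close> in \<open>b\<close> only, so
  \<open>h \<le> n - d + 1\<close>; and the \<open>d\<close> sets \<open>C\<^sub>b\<close> cover all variables, so \<open>n \<le> h d\<close>. If the first bound is
  attained, \<open>C\<^sub>b\<close> is everything outside \<open>B - b\<close>, arbitrary swaps are possible and all \<open>d\<close>-sets are
  bases. If the second one is attained, the \<open>C\<^sub>b\<close> are disjoint. Then every basis, having \<open>d\<close> elements
  and meeting each of the \<open>d\<close> blocks, is a transversal of them; all bases have the same blocks as
  fundamental cocircuits, so elements can be swapped freely inside a block and every transversal is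
  a basis (\<open>basis_iff_transversal\<close>). This says that \<open>I\<close> is the product of the ideals generated by
  the blocks.\<close>

section \<open>Algebraic dependence of more polynomials than variables\<close>

lemma poly_eq_sum_terms:
  fixes p :: "'a \<Rightarrow>\<^sub>0 'b::comm_monoid_add"
  shows "p = (\<Sum>w\<in>Poly_Mapping.keys p. Poly_Mapping.single w (Poly_Mapping.lookup p w))"
proof (rule poly_mapping_eqI)
  fix k
  show "Poly_Mapping.lookup p k = Poly_Mapping.lookup
      (\<Sum>w\<in>Poly_Mapping.keys p. Poly_Mapping.single w (Poly_Mapping.lookup p w)) k"
    by (cases "k \<in> Poly_Mapping.keys p")
       (auto simp: lookup_sum lookup_single when_def in_keys_iff sum.delta)
qed

lemma finite_exponents_le:
  "finite {w :: 'x::finite \<Rightarrow>\<^sub>0 nat. \<forall>x. Poly_Mapping.lookup w x \<le> k}"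
  and card_exponents_le:
  "card {w :: 'x::finite \<Rightarrow>\<^sub>0 nat. \<forall>x. Poly_Mapping.lookup w x \<le> k} \<le> (k + 1) ^ CARD('x)"
proof -
  let ?W = "{w :: 'x \<Rightarrow>\<^sub>0 nat. \<forall>x. Poly_Mapping.lookup w x \<le> k}"
  let ?F = "(UNIV :: 'x set) \<rightarrow>\<^sub>E {..k}"
  have inj: "inj_on Poly_Mapping.lookup ?W"
    by (auto intro!: inj_onI poly_mapping_eqI)
  have sub: "Poly_Mapping.lookup ` ?W \<subseteq> ?F" by auto
  have fin: "finite ?F" by (intro finite_PiE) auto
  show "finite ?W"
    using finite_imageD[OF finite_subset[OF sub fin] inj] .
  show "card ?W \<le> (k + 1) ^ CARD('x)"
    using card_inj_on_le[OF inj sub fin] by (simp add: card_PiE)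
qed

definition exponents_le :: "nat \<Rightarrow> ('x, 'k::field) mpoly \<Rightarrow> bool" where
  "exponents_le k p \<longleftrightarrow> (\<forall>w\<in>Poly_Mapping.keys p. \<forall>x. Poly_Mapping.lookup w x \<le> k)"

lemma exponents_le_mult:
  "exponents_le k p \<Longrightarrow> exponents_le l q \<Longrightarrow> exponents_le (k + l) (p * q)"
  using keys_mult[of p q] by (fastforce simp: exponents_le_def lookup_add intro: add_mono)

lemma exponents_le_1: "exponents_le 0 1"
  by (simp add: exponents_le_def)

lemma exponents_le_mono: "exponents_le k p \<Longrightarrow> k \<le> l \<Longrightarrow> exponents_le l p"
  by (meson exponents_le_def order_trans)

lemma exponents_le_power: "exponents_le k p \<Longrightarrow> exponents_le (k * e) (p ^ e)"
  by (induction e) (auto simp: exponents_le_1 intro: exponents_le_mult)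

lemma exponents_le_prod:
  "(\<And>i. i < m \<Longrightarrow> exponents_le k (g i)) \<Longrightarrow> exponents_le (m * k) (\<Prod>i<m. g i)"
proof (induction m)
  case (Suc m)
  thus ?case using exponents_le_mult[of "m * k" "\<Prod>i<m. g i" k "g m"] by (simp add: add.commute)
qed (simp add: exponents_le_1)

lemma exponents_le_exists:
  fixes p :: "('x::finite, 'k::field) mpoly"
  shows "\<exists>k. exponents_le k p"
proof
  let ?k = "\<Sum>w\<in>Poly_Mapping.keys p. \<Sum>x\<in>UNIV. Poly_Mapping.lookup w x"
  show "exponents_le ?k p"
    unfolding exponents_le_def
  proof (intro ballI allI)
    fix w x assume w: "w \<in> Poly_Mapping.keys p"
    have "Poly_Mapping.lookup w x \<le> (\<Sum>x\<in>UNIV. Poly_Mapping.lookup w x)"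
      by (rule member_le_sum) auto
    also have "\<dots> \<le> ?k"
      by (rule member_le_sum[of w _ "\<lambda>w. \<Sum>x\<in>UNIV. Poly_Mapping.lookup w x"]) (use w in auto)
    finally show "Poly_Mapping.lookup w x \<le> ?k" .
  qed
qed

lemma vector_space_polynomials:
  "vector_space (\<lambda>(c::'k::field) (p::('x, 'k) mpoly). Poly_Mapping.single 0 c * p)"
  by unfold_locales
    (auto simp: algebra_simps single_add mult_single simp flip: mult.assoc)

text \<open>A counting argument. There are \<open>(N + 1)^m\<close> products \<open>\<Prod>i<m. f i ^ a i\<close> with all exponents at most
  \<open>N\<close>, and the exponents of their monomials grow linearly with \<open>N\<close>. So they lie in a \<open>K\<close>-space of
  dimension \<open>O(N^n)\<close>, which is too small for large \<open>N\<close> as soon as \<open>n < m\<close>. The exponent families \<open>a\<close>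
  are extensional functions, so that two of them agreeing below \<open>m\<close> are equal.\<close>

lemma algebraically_dependent:
  fixes f :: "nat \<Rightarrow> ('x::finite, 'k::field) mpoly"
  assumes m: "CARD('x) < m"
  shows "\<exists>A c. finite A \<and> A \<noteq> {} \<and> A \<subseteq> {..<m} \<rightarrow>\<^sub>E (UNIV::nat set) \<and> (\<forall>a\<in>A. c a \<noteq> (0::'k)) \<and>
    (\<Sum>a\<in>A. Poly_Mapping.single 0 (c a) * (\<Prod>i<m. f i ^ a i)) = 0"
proof -
  interpret V: vector_space "\<lambda>(c::'k) (p::('x, 'k) mpoly). Poly_Mapping.single 0 c * p"
    by (rule vector_space_polynomials)
  let ?n = "CARD('x)"
  define F where "F a = (\<Prod>i<m. f i ^ a i)" for a :: "nat \<Rightarrow> nat"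
  obtain k where k: "exponents_le k (f i)" if "i < m" for i
  proof -
    have "\<forall>i. \<exists>k. exponents_le k (f i)" by (simp add: exponents_le_exists)
    then obtain k where "exponents_le (k i) (f i)" for i by metis
    hence "exponents_le (\<Sum>i<m. k i) (f i)" if "i < m" for i
      using that by (meson exponents_le_mono finite_lessThan lessThan_iff member_le_sum zero_le)
    thus ?thesis using that by blast
  qed
  define E where "E = m * k + 1"
  \<comment> \<open>With this \<open>N\<close>, the box of monomials has at most \<open>((N + 1) E)^n = (N + 1)^n N\<close> elements.\<close>
  define N where "N = E ^ ?n"
  define B where "B = {..<m} \<rightarrow>\<^sub>E {..N}"
  have finB: "finite B" by (auto simp: B_def intro: finite_PiE)
  have F_le: "exponents_le (m * (k * N)) (F a)" if "a \<in> B" for a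
    unfolding F_def
  proof (rule exponents_le_prod)
    fix i assume i: "i < m"
    hence "a i \<le> N" using that by (auto simp: B_def)
    thus "exponents_le (k * N) (f i ^ a i)"
      using exponents_le_power[OF k[OF i], of "a i"] by (rule_tac exponents_le_mono) auto
  qed
  define T where "T = (monomial ` {w. \<forall>x. Poly_Mapping.lookup w x \<le> m * (k * N)} :: ('x, 'k) mpoly set)"
  have finT: "finite T" by (simp add: T_def finite_exponents_le)
  have cardT: "card T < card B"
  proof -
    have "card T \<le> (m * (k * N) + 1) ^ ?n"
      unfolding T_def by (rule order_trans[OF card_image_le card_exponents_le]) (rule finite_exponents_le)
    also have "\<dots> \<le> ((N + 1) * E) ^ ?n"
      by (intro power_mono) (auto simp: E_def algebra_simps)
    also have "\<dots> = (N + 1) ^ ?n * N" by (simp only: power_mult_distrib N_def)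
    also have "\<dots> < (N + 1) ^ ?n * (N + 1)" by simp
    also have "\<dots> = (N + 1) ^ Suc ?n" by simp
    also have "\<dots> \<le> (N + 1) ^ m" using m by (intro power_increasing) auto
    also have "\<dots> = card B" by (simp add: B_def card_PiE)
    finally show ?thesis .
  qed
  have span: "F a \<in> V.span T" if "a \<in> B" for a
  proof -
    have "Poly_Mapping.single w (Poly_Mapping.lookup (F a) w) \<in> V.span T"
      if w: "w \<in> Poly_Mapping.keys (F a)" for w
    proof -
      have "Poly_Mapping.single 0 (Poly_Mapping.lookup (F a) w) * monomial w \<in> V.span T"
        using F_le[OF \<open>a \<in> B\<close>] w
        by (intro V.span_scale V.span_base) (auto simp: T_def exponents_le_def)
      thus ?thesis by (simp add: monomial_def mult_single)
    qed
    thus ?thesis by (subst poly_eq_sum_terms) (rule V.span_sum)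
  qed
  have sub: "A \<subseteq> {..<m} \<rightarrow>\<^sub>E UNIV" if "A \<subseteq> B" for A
    using that unfolding B_def by (meson PiE_mono subset_UNIV subset_trans)
  show ?thesis
  proof (cases "inj_on F B")
    case False
    then obtain a b where ab: "a \<in> B" "b \<in> B" "a \<noteq> b" "F a = F b" by (auto simp: inj_on_def)
    \<comment> \<open>Two equal products already give a relation, with coefficients \<open>1\<close> and \<open>-1\<close>.\<close>
    let ?c = "\<lambda>x. if x = a then 1 else - 1 :: 'k"
    have "(\<Sum>x\<in>{a, b}. Poly_Mapping.single 0 (?c x) * F x) = 0"
      using ab by (simp add: single_uminus)
    thus ?thesis
      using ab sub[of "{a, b}"]
      by (intro exI[of _ "{a, b}"] exI[of _ ?c]) (auto simp: F_def)
  next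
    case True
    have "V.dependent (F ` B)"
      using V.independent_span_bound[OF finT, of "F ` B"] span cardT True
      by (auto simp: card_image)
    then obtain t u where t: "finite t" "t \<subseteq> F ` B"
      "(\<Sum>v\<in>t. Poly_Mapping.single 0 (u v) * v) = 0" "\<exists>v\<in>t. u v \<noteq> 0"
      by (auto simp: V.dependent_explicit)
    define A where "A = {a\<in>B. F a \<in> t \<and> u (F a) \<noteq> 0}"
    have inj: "inj_on F A" using True by (auto simp: A_def inj_on_def)
    have "(\<Sum>a\<in>A. Poly_Mapping.single 0 (u (F a)) * F a)
        = (\<Sum>v\<in>F ` A. Poly_Mapping.single 0 (u v) * v)"
      by (simp add: sum.reindex[OF inj])
    also have "\<dots> = (\<Sum>v\<in>t. Poly_Mapping.single 0 (u v) * v)"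
      using t by (intro sum.mono_neutral_left) (auto simp: A_def)
    finally have "(\<Sum>a\<in>A. Poly_Mapping.single 0 (u (F a)) * F a) = 0" using t(3) by simp
    moreover have "finite A" "A \<noteq> {}" "A \<subseteq> B" using finB t(2,4) by (auto simp: A_def)
    ultimately show ?thesis
      using sub[of A] by (intro exI[of _ A] exI[of _ "\<lambda>a. u (F a)"]) (auto simp: F_def A_def)
  qed
qed

section \<open>Chains of prime ideals\<close>

lemma polynomial_ring_primeD:
  fixes P :: "('x, 'k::field) mpoly set"
  assumes "primeideal P polynomial_ring"
  shows polynomial_prime_zero: "0 \<in> P"
    and polynomial_prime_add: "p \<in> P \<Longrightarrow> q \<in> P \<Longrightarrow> p + q \<in> P"
    and polynomial_prime_mult: "p \<in> P \<Longrightarrow> r * p \<in> P"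
    and polynomial_prime_prime: "p * q \<in> P \<Longrightarrow> p \<in> P \<or> q \<in> P"
    and polynomial_prime_one: "1 \<notin> P"
proof -
  interpret P: primeideal P polynomial_ring by fact
  show "0 \<in> P"
    using additive_subgroup.zero_closed[OF P.additive_subgroup_axioms] by (simp add: polynomial_ring_simps)
  show "p \<in> P \<Longrightarrow> q \<in> P \<Longrightarrow> p + q \<in> P"
    using additive_subgroup.a_closed[OF P.additive_subgroup_axioms, of p q]
    by (simp add: polynomial_ring_simps)
  show mult: "r * p \<in> P" if "p \<in> P" for r p
    using P.I_l_closed[OF that, of r] by (simp add: polynomial_ring_simps)
  show "p * q \<in> P \<Longrightarrow> p \<in> P \<or> q \<in> P" using P.I_prime[of p q] by (simp add: polynomial_ring_simps)
  show "1 \<notin> P"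
    using mult[of 1] P.I_notcarr by (auto simp: polynomial_ring_simps)
qed

lemma polynomial_prime_sum:
  assumes "primeideal P polynomial_ring" "\<And>i. i \<in> A \<Longrightarrow> f i \<in> P"
  shows "sum f A \<in> P"
  using assms(2)
  by (induction A rule: infinite_finite_induct)
     (auto simp: polynomial_prime_zero[OF assms(1)] polynomial_prime_add[OF assms(1)])

lemma polynomial_prime_power:
  assumes "primeideal P polynomial_ring" "p ^ e * q \<in> P" "p \<notin> P"
  shows "q \<in> P"
  using assms(2)
proof (induction e)
  case (Suc e)
  thus ?case using polynomial_prime_prime[OF assms(1), of p "p ^ e * q"] assms(3)
    by (simp add: mult.assoc)
qed simp

lemma polynomial_prime_unit:
  assumes "primeideal P polynomial_ring" "c \<noteq> 0"
  shows "Poly_Mapping.single 0 c \<notin> P"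
proof
  assume "Poly_Mapping.single 0 c \<in> P"
  from polynomial_prime_mult[OF assms(1) this, of "Poly_Mapping.single 0 (inverse c)"]
  show False using assms(2) polynomial_prime_one[OF assms(1)] by (simp add: mult_single)
qed

text \<open>The Krull dimension is at most the number of variables. Suppose a chain had length \<open>m > n\<close> and pick
  \<open>f i\<close> in \<open>C (i + 1)\<close> but not in \<open>C i\<close>. Start with an algebraic relation between the \<open>f i\<close>, an
  element of \<open>C 0\<close>, and climb the chain. At step \<open>j\<close>, divide out the least power of \<open>f j\<close> that
  occurs, which is possible because \<open>f j\<close> is not in the prime \<open>C j\<close>; then discard the terms that
  still contain \<open>f j\<close>, as these lie in \<open>C (j + 1)\<close>. In the end only the lexicographically least term
  survives, and its nonzero coefficient lies in \<open>C m\<close>.\<close>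

lemma prime_chain_length_le:
  fixes C :: "nat \<Rightarrow> ('x::finite, 'k::field) mpoly set"
  assumes prime: "\<And>i. i \<le> m \<Longrightarrow> primeideal (C i) polynomial_ring"
    and chain: "\<And>i. i < m \<Longrightarrow> C i \<subset> C (Suc i)"
  shows "m \<le> CARD('x)"
proof (rule ccontr)
  assume "\<not> ?thesis"
  hence m: "CARD('x) < m" by simp
  have "\<exists>p. p \<in> C (Suc i) - C i" if "i < m" for i using chain[OF that] by blast
  then obtain f where f: "i < m \<Longrightarrow> f i \<in> C (Suc i) - C i" for i by metis
  obtain A c where A: "finite A" "A \<noteq> {}" "A \<subseteq> {..<m} \<rightarrow>\<^sub>E (UNIV::nat set)"
    "\<And>a. a \<in> A \<Longrightarrow> c a \<noteq> (0::'k)"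
    "(\<Sum>a\<in>A. Poly_Mapping.single 0 (c a) * (\<Prod>i<m. f i ^ a i)) = 0"
    using algebraically_dependent[OF m, of f] by blast
  have "\<exists>B. B \<subseteq> A \<and> B \<noteq> {} \<and> (\<forall>a\<in>B. \<forall>b\<in>B. \<forall>i<j. a i = b i) \<and>
      (\<Sum>a\<in>B. Poly_Mapping.single 0 (c a) * (\<Prod>i=j..<m. f i ^ a i)) \<in> C j" if "j \<le> m" for j
    using that
  proof (induction j)
    case 0
    show ?case
      using A polynomial_prime_zero[OF prime[of 0]] by (intro exI[of _ A]) (simp add: atLeast0LessThan)
  next
    case (Suc j)
    hence j: "j < m" by simp
    from Suc.IH j obtain B where B: "B \<subseteq> A" "B \<noteq> {}" "\<forall>a\<in>B. \<forall>b\<in>B. \<forall>i<j. a i = b i"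
      "(\<Sum>a\<in>B. Poly_Mapping.single 0 (c a) * (\<Prod>i=j..<m. f i ^ a i)) \<in> C j" by auto
    have finB: "finite B" using B(1) A(1) finite_subset by blast
    define e where "e = Min ((\<lambda>a. a j) ` B)"
    have e_le: "e \<le> a j" if "a \<in> B" for a using that finB by (simp add: e_def)
    have "e \<in> (\<lambda>a. a j) ` B" unfolding e_def using finB B(2) by (intro Min_in) auto
    then obtain a0 where a0: "a0 \<in> B" "a0 j = e" by auto
    define g where "g a = Poly_Mapping.single 0 (c a) * (f j ^ (a j - e) * (\<Prod>i=Suc j..<m. f i ^ a i))" for a
    define B' where "B' = {a\<in>B. a j = e}"
    have "(\<Sum>a\<in>B. Poly_Mapping.single 0 (c a) * (\<Prod>i=j..<m. f i ^ a i)) = f j ^ e * (\<Sum>a\<in>B. g a)"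
      unfolding sum_distrib_left
    proof (rule sum.cong)
      fix a assume "a \<in> B"
      hence "f j ^ a j = f j ^ e * f j ^ (a j - e)" using e_le[of a] by (simp flip: power_add)
      thus "Poly_Mapping.single 0 (c a) * (\<Prod>i=j..<m. f i ^ a i) = f j ^ e * g a"
        using j by (simp add: g_def prod.atLeast_Suc_lessThan mult_ac)
    qed simp
    with B(4) have "(\<Sum>a\<in>B. g a) \<in> C j"
      using polynomial_prime_power[OF prime[of j]] f[OF j] j by auto
    hence all: "(\<Sum>a\<in>B. g a) \<in> C (Suc j)" using chain[OF j] by blast
    note P = prime[OF Suc.prems]
    have rest: "(\<Sum>a\<in>B - B'. g a) \<in> C (Suc j)"
    proof (rule polynomial_prime_sum[OF P])
      fix a assume "a \<in> B - B'"
      hence "0 < a j - e" using e_le[of a] by (auto simp: B'_def)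
      then obtain k where k: "a j - e = Suc k" using gr0_implies_Suc by blast
      have "g a = (Poly_Mapping.single 0 (c a) * f j ^ k * (\<Prod>i=Suc j..<m. f i ^ a i)) * f j"
        by (simp add: g_def k mult_ac)
      also have "\<dots> \<in> C (Suc j)" by (rule polynomial_prime_mult[OF P]) (use f[OF j] in simp)
      finally show "g a \<in> C (Suc j)" .
    qed
    have "(\<Sum>a\<in>B. g a) = (\<Sum>a\<in>B - B'. g a) + (\<Sum>a\<in>B'. g a)"
      by (rule sum.subset_diff) (use finB in \<open>auto simp: B'_def\<close>)
    hence "(\<Sum>a\<in>B'. g a) = (\<Sum>a\<in>B. g a) + (- 1) * (\<Sum>a\<in>B - B'. g a)" by simp
    also have "\<dots> \<in> C (Suc j)"
      by (rule polynomial_prime_add[OF P all polynomial_prime_mult[OF P rest]])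
    also have "(\<Sum>a\<in>B'. g a) = (\<Sum>a\<in>B'. Poly_Mapping.single 0 (c a) * (\<Prod>i=Suc j..<m. f i ^ a i))"
      by (rule sum.cong) (auto simp: g_def B'_def)
    finally have mem: "(\<Sum>a\<in>B'. Poly_Mapping.single 0 (c a) * (\<Prod>i=Suc j..<m. f i ^ a i)) \<in> C (Suc j)" .
    have "\<forall>a\<in>B'. \<forall>b\<in>B'. \<forall>i<Suc j. a i = b i"
      using B(3) by (auto simp: B'_def less_Suc_eq)
    thus ?case using mem B(1) a0 by (intro exI[of _ B']) (auto simp: B'_def)
  qed
  from this[of m] obtain B where B: "B \<subseteq> A" "B \<noteq> {}" "\<forall>a\<in>B. \<forall>b\<in>B. \<forall>i<m. a i = b i"
    "(\<Sum>a\<in>B. Poly_Mapping.single 0 (c a)) \<in> C m" by auto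
  obtain a where a: "a \<in> B" using B(2) by blast
  have eq: "b = a" if "b \<in> B" for b
    by (rule PiE_ext[of b "{..<m}" "\<lambda>_. UNIV" a]) (use that a A(3) B(1,3) in auto)
  have "B = {a}" using a eq by blast
  hence "Poly_Mapping.single 0 (c a) \<in> C m" using B(4) by simp
  thus False using polynomial_prime_unit[OF prime[of m] A(4)[of a]] a B(1) by auto
qed

section \<open>Square-free monomials and ideals generated by variables\<close>

definition variable_ideal :: "'x set \<Rightarrow> ('x, 'k::field) mpoly set" where
  "variable_ideal S = ideal_of_monomials ((\<lambda>x. Poly_Mapping.single x 1) ` S)"

lemma exponent_summand_iff:
  fixes u w :: "'x \<Rightarrow>\<^sub>0 nat"
  shows "(\<exists>v. w = u + v) \<longleftrightarrow> (\<forall>x. Poly_Mapping.lookup u x \<le> Poly_Mapping.lookup w x)"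
proof
  assume "\<forall>x. Poly_Mapping.lookup u x \<le> Poly_Mapping.lookup w x"
  hence "w = u + (w - u)" by (intro poly_mapping_eqI) (simp add: lookup_add lookup_minus)
  thus "\<exists>v. w = u + v" ..
qed (auto simp: lookup_add)

lemma square_free_lookup:
  assumes "square_free u"
  shows "Poly_Mapping.lookup u x = (if x \<in> Poly_Mapping.keys u then 1 else 0)"
proof -
  have "Poly_Mapping.lookup u x \<le> 1" using assms by (simp add: square_free_def)
  thus ?thesis by (auto simp: in_keys_iff)
qed

lemma square_free_summand_iff:
  assumes "square_free u"
  shows "(\<exists>v. w = u + v) \<longleftrightarrow> Poly_Mapping.keys u \<subseteq> Poly_Mapping.keys w"
proof -
  have "Poly_Mapping.lookup u x \<le> Poly_Mapping.lookup w x
      \<longleftrightarrow> (x \<in> Poly_Mapping.keys u \<longrightarrow> x \<in> Poly_Mapping.keys w)" for x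
    unfolding square_free_lookup[OF assms] by (simp add: in_keys_iff[of x w] Suc_le_eq)
  thus ?thesis unfolding exponent_summand_iff by auto
qed

lemma square_free_eqI:
  "square_free u \<Longrightarrow> square_free v \<Longrightarrow> Poly_Mapping.keys u = Poly_Mapping.keys v \<Longrightarrow> u = v"
  by (rule poly_mapping_eqI) (simp add: square_free_lookup)

lemma square_free_degree: "square_free u \<Longrightarrow> monomial_degree u = card (Poly_Mapping.keys u)"
  by (simp add: monomial_degree_def square_free_lookup)

lemma square_free_single: "square_free (Poly_Mapping.single x 1)"
  by (simp add: square_free_def lookup_single when_def)

definition set_exponent :: "'x set \<Rightarrow> 'x \<Rightarrow>\<^sub>0 nat" where
  "set_exponent A = (\<Sum>x\<in>A. Poly_Mapping.single x 1)"

lemma lookup_set_exponent: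
  "finite A \<Longrightarrow> Poly_Mapping.lookup (set_exponent A) x = (if x \<in> A then 1 else 0)"
  by (simp add: set_exponent_def lookup_sum lookup_single when_def)

lemma keys_set_exponent: "finite A \<Longrightarrow> Poly_Mapping.keys (set_exponent A) = A"
  by (auto simp: in_keys_iff lookup_set_exponent split: if_splits)

lemma square_free_set_exponent: "finite A \<Longrightarrow> square_free (set_exponent A)"
  by (simp add: square_free_def lookup_set_exponent)

lemma set_exponent_keys: "square_free u \<Longrightarrow> set_exponent (Poly_Mapping.keys u) = u"
  by (rule square_free_eqI) (simp_all add: square_free_set_exponent keys_set_exponent)

lemma keys_plus_nat:
  fixes u v :: "'x \<Rightarrow>\<^sub>0 nat"
  shows "Poly_Mapping.keys (u + v) = Poly_Mapping.keys u \<union> Poly_Mapping.keys v"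
  by (auto simp: in_keys_iff lookup_add)

lemma prod_monomial: "(\<Prod>i\<in>A. monomial (u i)) = (monomial (\<Sum>i\<in>A. u i) :: ('x, 'k::field) mpoly)"
  by (induction A rule: infinite_finite_induct) (auto simp: monomial_mult, auto simp: monomial_def)

lemma ideal_of_monomials_iff:
  fixes p :: "('x, 'k::field) mpoly"
  shows "p \<in> ideal_of_monomials M \<longleftrightarrow> (\<forall>w\<in>Poly_Mapping.keys p. \<exists>u\<in>M. \<exists>v. w = u + v)"
proof
  assume "p \<in> ideal_of_monomials M"
  thus "\<forall>w\<in>Poly_Mapping.keys p. \<exists>u\<in>M. \<exists>v. w = u + v"
    by (intro ballI keys_ideal_of_monomials)
next
  assume R: "\<forall>w\<in>Poly_Mapping.keys p. \<exists>u\<in>M. \<exists>v. w = u + v"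
  interpret J: ideal "ideal_of_monomials M :: ('x, 'k) mpoly set" polynomial_ring
    by (rule ideal_ideal_of_monomials)
  have 0: "(0 :: ('x, 'k) mpoly) \<in> ideal_of_monomials M"
    using additive_subgroup.zero_closed[OF J.additive_subgroup_axioms]
    by (simp add: polynomial_ring_simps)
  have add: "p + q \<in> ideal_of_monomials M" if "p \<in> ideal_of_monomials M" "q \<in> ideal_of_monomials M"
    for p q :: "('x, 'k) mpoly"
    using additive_subgroup.a_closed[OF J.additive_subgroup_axioms that]
    by (simp add: polynomial_ring_simps)
  have sum: "sum f A \<in> ideal_of_monomials M" if "\<And>w. w \<in> A \<Longrightarrow> f w \<in> ideal_of_monomials M"
    for f :: "('x \<Rightarrow>\<^sub>0 nat) \<Rightarrow> ('x, 'k) mpoly" and A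
    using that by (induction A rule: infinite_finite_induct) (auto simp: 0 add)
  have "Poly_Mapping.single w (Poly_Mapping.lookup p w) \<in> ideal_of_monomials M"
    if "w \<in> Poly_Mapping.keys p" for w
  proof -
    have "monomial w \<in> (ideal_of_monomials M :: ('x, 'k) mpoly set)"
      using R that by (simp add: monomial_in_ideal_of_monomials_iff)
    from J.I_l_closed[OF this, of "Poly_Mapping.single 0 (Poly_Mapping.lookup p w)"] show ?thesis
      by (simp add: polynomial_ring_simps monomial_def mult_single)
  qed
  hence "(\<Sum>w\<in>Poly_Mapping.keys p. Poly_Mapping.single w (Poly_Mapping.lookup p w)) \<in> ideal_of_monomials M"
    by (rule sum)
  thus "p \<in> ideal_of_monomials M"
    unfolding poly_eq_sum_terms[of p, symmetric] .
qed

lemma ideal_of_square_free_monomials_iff: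
  assumes "\<forall>u\<in>M. square_free u"
  shows "p \<in> ideal_of_monomials M \<longleftrightarrow>
    (\<forall>w\<in>Poly_Mapping.keys p. \<exists>u\<in>M. Poly_Mapping.keys u \<subseteq> Poly_Mapping.keys w)"
proof -
  have "(\<exists>u\<in>M. \<exists>v. w = u + v) \<longleftrightarrow> (\<exists>u\<in>M. Poly_Mapping.keys u \<subseteq> Poly_Mapping.keys w)" for w
    by (intro bex_cong refl square_free_summand_iff bspec[OF assms])
  thus ?thesis unfolding ideal_of_monomials_iff by simp
qed

lemma variable_ideal_iff:
  "p \<in> variable_ideal S \<longleftrightarrow> (\<forall>w\<in>Poly_Mapping.keys p. Poly_Mapping.keys w \<inter> S \<noteq> {})"
proof -
  have "(\<exists>u\<in>(\<lambda>x. Poly_Mapping.single x (1::nat)) ` S. Poly_Mapping.keys u \<subseteq> Poly_Mapping.keys w)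
      \<longleftrightarrow> Poly_Mapping.keys w \<inter> S \<noteq> {}" for w :: "'a \<Rightarrow>\<^sub>0 nat"
    by auto
  moreover have "\<forall>u\<in>(\<lambda>x. Poly_Mapping.single x 1) ` S. square_free (u :: 'a \<Rightarrow>\<^sub>0 nat)"
    by (auto simp: square_free_def lookup_single when_def)
  ultimately show ?thesis
    unfolding variable_ideal_def by (simp only: ideal_of_square_free_monomials_iff)
qed

lemma lookup_mult_keys:
  fixes p q :: "('x, 'k::field) mpoly"
  shows "Poly_Mapping.lookup (p * q) w = (\<Sum>(a, b)\<in>Poly_Mapping.keys p \<times> Poly_Mapping.keys q.
    (Poly_Mapping.lookup p a * Poly_Mapping.lookup q b when a + b = w))"
proof -
  have "p * q = (\<Sum>a\<in>Poly_Mapping.keys p. Poly_Mapping.single a (Poly_Mapping.lookup p a)) *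
      (\<Sum>b\<in>Poly_Mapping.keys q. Poly_Mapping.single b (Poly_Mapping.lookup q b))"
    by (rule arg_cong2[where f = "(*)"]) (rule poly_eq_sum_terms)+
  also have "\<dots> = (\<Sum>(a, b)\<in>Poly_Mapping.keys p \<times> Poly_Mapping.keys q.
      Poly_Mapping.single (a + b) (Poly_Mapping.lookup p a * Poly_Mapping.lookup q b))"
    by (simp only: sum_product mult_single sum.cartesian_product)
  finally have eq: "p * q = \<dots>" .
  show ?thesis
    unfolding eq by (simp add: lookup_sum lookup_single case_prod_unfold)
qed

lemma lookup_mult_monomial:
  fixes p :: "('x, 'k::field) mpoly"
  shows "Poly_Mapping.lookup (p * monomial u) (w + u) = Poly_Mapping.lookup p w"
proof -
  have "Poly_Mapping.lookup (p * monomial u) (w + u)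
      = (\<Sum>a\<in>Poly_Mapping.keys p. Poly_Mapping.lookup p a when a = w)"
    unfolding lookup_mult_keys sum.cartesian_product[symmetric] by (simp add: monomial_def)
  also have "\<dots> = Poly_Mapping.lookup p w"
    by (simp add: when_def in_keys_iff)
  finally show ?thesis .
qed

text \<open>The sums of two finite sets of exponent vectors include one with a unique representation. This
  replaces the choice of a monomial order on the variables, which carry no order here: restrict both
  sets to the vectors with the largest coordinate \<open>x\<close>, for one variable \<open>x\<close> after the other. Each
  restriction is a face, i.e. two summands of a sum from the smaller sets lie in the smaller sets,
  and in the end one vector is left on either side.\<close>

lemma unique_sum_of_exponents:
  fixes A B :: "('x::finite \<Rightarrow>\<^sub>0 nat) set"
  assumes "finite A" "A \<noteq> {}" "finite B" "B \<noteq> {}"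
  shows "\<exists>u\<in>A. \<exists>v\<in>B. \<forall>a\<in>A. \<forall>b\<in>B. a + b = u + v \<longrightarrow> a = u \<and> b = v"
proof -
  define face where "face A' B' \<longleftrightarrow> A' \<subseteq> A \<and> B' \<subseteq> B \<and>
    (\<forall>u\<in>A'. \<forall>v\<in>B'. \<forall>a\<in>A. \<forall>b\<in>B. a + b = u + v \<longrightarrow> a \<in> A' \<and> b \<in> B')" for A' B'
  define agree where "agree V S \<longleftrightarrow>
    (\<forall>s\<in>S. \<forall>t\<in>S. \<forall>x\<in>V. Poly_Mapping.lookup s x = Poly_Mapping.lookup t x)"
    for V :: "'x set" and S :: "('x \<Rightarrow>\<^sub>0 nat) set"
  have "\<exists>A' B'. A' \<noteq> {} \<and> B' \<noteq> {} \<and> face A' B' \<and> agree V A' \<and> agree V B'" for V :: "'x set"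
    using finite[of V]
  proof (induction V rule: finite_induct)
    case empty
    have "face A B" "agree {} A" "agree {} B" by (simp_all add: face_def agree_def)
    thus ?case using assms by blast
  next
    case (insert x V)
    then obtain A' B' where AB: "A' \<noteq> {}" "B' \<noteq> {}" "face A' B'" "agree V A'" "agree V B'"
      by blast
    have max: "\<exists>k. (\<forall>s\<in>S. Poly_Mapping.lookup s x \<le> k) \<and> (\<exists>s\<in>S. Poly_Mapping.lookup s x = k)"
      if S: "finite S" "S \<noteq> {}" for S :: "('x \<Rightarrow>\<^sub>0 nat) set"
    proof -
      let ?L = "(\<lambda>s. Poly_Mapping.lookup s x) ` S"
      have "Max ?L \<in> ?L" using S by (intro Max_in) auto
      then obtain s where "s \<in> S" "Poly_Mapping.lookup s x = Max ?L" by (elim imageE) simp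
      moreover have "\<forall>s\<in>S. Poly_Mapping.lookup s x \<le> Max ?L"
        using S(1) by (intro ballI Max_ge) simp_all
      ultimately show ?thesis by (intro exI[of _ "Max ?L"] conjI bexI[of _ s])
    qed
    have sub: "A' \<subseteq> A" "B' \<subseteq> B" using AB(3) by (simp_all add: face_def)
    have fin: "finite A'" "finite B'"
      using finite_subset[OF sub(1) assms(1)] finite_subset[OF sub(2) assms(3)] by simp_all
    obtain k where k: "\<forall>s\<in>A'. Poly_Mapping.lookup s x \<le> k" "\<exists>s\<in>A'. Poly_Mapping.lookup s x = k"
      using max[OF fin(1) AB(1)] by blast
    obtain l where l: "\<forall>s\<in>B'. Poly_Mapping.lookup s x \<le> l" "\<exists>s\<in>B'. Poly_Mapping.lookup s x = l"
      using max[OF fin(2) AB(2)] by blast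
    let ?A = "{a\<in>A'. Poly_Mapping.lookup a x = k}" and ?B = "{b\<in>B'. Poly_Mapping.lookup b x = l}"
    have step: "a \<in> ?A \<and> b \<in> ?B"
      if uv: "u \<in> ?A" "v \<in> ?B" "a \<in> A" "b \<in> B" and eq: "a + b = u + v" for u v a b
    proof -
      have ab: "a \<in> A'" "b \<in> B'" using AB(3) uv eq unfolding face_def by auto
      have "Poly_Mapping.lookup (a + b) x = Poly_Mapping.lookup (u + v) x" by (simp add: eq)
      hence "Poly_Mapping.lookup a x + Poly_Mapping.lookup b x = k + l"
        using uv by (simp add: lookup_add)
      moreover have "Poly_Mapping.lookup a x \<le> k" "Poly_Mapping.lookup b x \<le> l"
        using k(1) l(1) ab by simp_all
      ultimately show ?thesis using ab by simp
    qed
    have "face ?A ?B"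
      unfolding face_def
    proof (intro conjI)
      show "?A \<subseteq> A" "?B \<subseteq> B" using sub by auto
      show "\<forall>u\<in>?A. \<forall>v\<in>?B. \<forall>a\<in>A. \<forall>b\<in>B. a + b = u + v \<longrightarrow> a \<in> ?A \<and> b \<in> ?B"
        by (intro ballI impI) (rule step)
    qed
    moreover have "agree (insert x V) S'" if "S' = {s\<in>S. Poly_Mapping.lookup s x = j}" "agree V S" for S S' j
      using that(2) unfolding agree_def that(1) by simp
    hence "agree (insert x V) ?A" "agree (insert x V) ?B" using AB(4,5) by blast+
    moreover have "?A \<noteq> {}" "?B \<noteq> {}" using k(2) l(2) by auto
    ultimately show ?case by (intro exI[of _ ?A] exI[of _ ?B] conjI)
  qed
  from this[of UNIV] obtain A' B' where AB: "A' \<noteq> {}" "B' \<noteq> {}" "face A' B'"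
    "agree UNIV A'" "agree UNIV B'" by blast
  then obtain u v where uv: "u \<in> A'" "v \<in> B'" by blast
  have sub: "A' \<subseteq> A" "B' \<subseteq> B"
    and closed: "\<forall>u\<in>A'. \<forall>v\<in>B'. \<forall>a\<in>A. \<forall>b\<in>B. a + b = u + v \<longrightarrow> a \<in> A' \<and> b \<in> B'"
    using AB(3) unfolding face_def by iprover+
  have eqI: "s = t" if "agree UNIV S" "s \<in> S" "t \<in> S" for S s t
    by (rule poly_mapping_eqI) (use that in \<open>unfold agree_def, blast\<close>)
  show ?thesis
  proof (intro bexI ballI impI)
    fix a b assume "a \<in> A" "b \<in> B" "a + b = u + v"
    hence "a \<in> A' \<and> b \<in> B'" using closed[rule_format, OF uv] by iprover
    thus "a = u \<and> b = v" using eqI[OF AB(4) _ uv(1)] eqI[OF AB(5) _ uv(2)] by iprover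
  qed (use uv sub in auto)
qed

text \<open>If neither \<open>p\<close> nor \<open>q\<close> is in the ideal, both have monomials free of the variables of \<open>S\<close>. Among
  these, a pair whose sum has a unique representation produces a monomial of \<open>p * q\<close> that is again
  free of \<open>S\<close> and has a nonzero coefficient.\<close>

lemma primeideal_variable_ideal:
  "primeideal (variable_ideal S :: ('x::finite, 'k::field) mpoly set) polynomial_ring"
proof (rule primeidealI)
  let ?P = "variable_ideal S :: ('x, 'k) mpoly set"
  show "ideal ?P polynomial_ring" unfolding variable_ideal_def by (rule ideal_ideal_of_monomials)
  show "cring (polynomial_ring :: ('x, 'k) mpoly ring)" by (rule cring_from_type_algebra)
  have "(1 :: ('x, 'k) mpoly) \<notin> ?P" by (simp add: variable_ideal_iff)
  thus "carrier polynomial_ring \<noteq> ?P" by (auto simp: polynomial_ring_simps)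
  fix p q :: "('x, 'k) mpoly"
  assume "p \<otimes>\<^bsub>polynomial_ring\<^esub> q \<in> ?P"
  hence pq: "p * q \<in> ?P" by (simp add: polynomial_ring_simps)
  show "p \<in> ?P \<or> q \<in> ?P"
  proof (rule ccontr)
    assume neg: "\<not> (p \<in> ?P \<or> q \<in> ?P)"
    let ?A = "{w\<in>Poly_Mapping.keys p. Poly_Mapping.keys w \<inter> S = {}}"
    let ?B = "{w\<in>Poly_Mapping.keys q. Poly_Mapping.keys w \<inter> S = {}}"
    from neg have ne: "?A \<noteq> {}" "?B \<noteq> {}" by (auto simp: variable_ideal_iff)
    obtain u v where uv: "u \<in> ?A" "v \<in> ?B"
      "\<And>a b. a \<in> ?A \<Longrightarrow> b \<in> ?B \<Longrightarrow> a + b = u + v \<Longrightarrow> a = u \<and> b = v"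
      using unique_sum_of_exponents[OF _ ne(1) _ ne(2)] by force
    have avoid: "Poly_Mapping.keys (u + v) \<inter> S = {}" using uv by (auto simp: keys_plus_nat)
    have only: "a = u \<and> b = v"
      if ab: "a \<in> Poly_Mapping.keys p" "b \<in> Poly_Mapping.keys q" "a + b = u + v" for a b
    proof -
      have "(Poly_Mapping.keys a \<union> Poly_Mapping.keys b) \<inter> S = {}"
        using avoid unfolding keys_plus_nat[symmetric] ab(3) .
      thus ?thesis using ab by (intro uv(3)) auto
    qed
    have "Poly_Mapping.lookup (p * q) (u + v) =
        (\<Sum>(a, b)\<in>{(u, v)}. Poly_Mapping.lookup p a * Poly_Mapping.lookup q b when a + b = u + v)"
      unfolding lookup_mult_keys
    proof (rule sum.mono_neutral_right)
      show "{(u, v)} \<subseteq> Poly_Mapping.keys p \<times> Poly_Mapping.keys q" using uv(1,2) by simp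
      show "\<forall>ab\<in>Poly_Mapping.keys p \<times> Poly_Mapping.keys q - {(u, v)}.
          (case ab of (a, b) \<Rightarrow>
            Poly_Mapping.lookup p a * Poly_Mapping.lookup q b when a + b = u + v) = 0"
      proof
        fix ab assume "ab \<in> Poly_Mapping.keys p \<times> Poly_Mapping.keys q - {(u, v)}"
        then obtain a b where ab: "ab = (a, b)" "a \<in> Poly_Mapping.keys p" "b \<in> Poly_Mapping.keys q"
          "\<not> (a = u \<and> b = v)" by (cases ab) simp
        with only have "a + b \<noteq> u + v" by blast
        thus "(case ab of (a, b) \<Rightarrow>
            Poly_Mapping.lookup p a * Poly_Mapping.lookup q b when a + b = u + v) = 0"
          by (simp add: ab(1))
      qed
    qed simp
    also have "\<dots> \<noteq> 0" using uv by (simp add: in_keys_iff)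
    finally have "u + v \<in> Poly_Mapping.keys (p * q)" by (simp add: in_keys_iff)
    with pq avoid show False by (auto simp: variable_ideal_iff)
  qed
qed

lemma variable_in_variable_ideal_iff:
  "(variable x :: ('x, 'k::field) mpoly) \<in> variable_ideal S \<longleftrightarrow> x \<in> S"
  by (simp add: variable_ideal_iff variable_def monomial_def)

lemma variable_ideal_strict_mono:
  "S \<subset> T \<Longrightarrow> (variable_ideal S :: ('x, 'k::field) mpoly set) \<subset> variable_ideal T"
proof
  assume ST: "S \<subset> T"
  show "(variable_ideal S :: ('x, 'k) mpoly set) \<subseteq> variable_ideal T"
  proof
    fix p :: "('x, 'k) mpoly" assume "p \<in> variable_ideal S"
    thus "p \<in> variable_ideal T" unfolding variable_ideal_iff using ST by blast
  qed
  obtain x where "x \<in> T" "x \<notin> S" using ST by blast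
  thus "(variable_ideal S :: ('x, 'k) mpoly set) \<noteq> variable_ideal T"
    by (metis variable_in_variable_ideal_iff)
qed

section \<open>The height of an ideal generated by variables\<close>

lemma prime_chain_le_height:
  assumes "\<And>i. i \<le> m \<Longrightarrow> primeideal (C i) R" "\<And>i. i < m \<Longrightarrow> C i \<subset> C (Suc i)"
  shows "enat m \<le> prime_height R (C m)"
  unfolding prime_height_def using assms by (intro SUP_upper) auto

lemma prime_height_mono:
  assumes "primeideal Q R" "P \<subseteq> Q"
  shows "prime_height R P \<le> prime_height R Q"
proof -
  have "enat m \<le> prime_height R Q"
    if C: "\<forall>i\<le>m. primeideal (C i) R" "\<forall>i<m. C i \<subset> C (Suc i)" "C m = P" for m C
  proof -
    have "enat m \<le> prime_height R ((C(m := Q)) m)"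
      by (rule prime_chain_le_height) (use C assms in \<open>auto simp: less_Suc_eq psubset_subset_trans\<close>)
    thus ?thesis by simp
  qed
  thus ?thesis unfolding prime_height_def[of R P] by (intro SUP_least) auto
qed

text \<open>Adjoining the variables of \<open>S\<close> one by one gives a chain of length \<open>card S\<close>. For the converse, any
  chain up to the ideal of \<open>S\<close> is prolonged by adjoining the remaining variables one by one, and the
  dimension bound applies to the longer chain.\<close>

lemma prime_height_variable_ideal:
  "prime_height polynomial_ring (variable_ideal S :: ('x::finite, 'k::field) mpoly set) = enat (card S)"
proof (rule antisym)
  let ?V = "variable_ideal :: 'x set \<Rightarrow> ('x, 'k) mpoly set"
  have image_psubset: "e ` {..<i} \<subset> e ` {..<Suc i}"
    if e: "inj_on e {0..<t}" and i: "i < t" for e :: "nat \<Rightarrow> 'x" and i t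
  proof -
    have "e i \<notin> e ` {..<i}" using inj_onD[OF e, of i] i by force
    thus ?thesis by (auto simp: lessThan_Suc)
  qed
  obtain e where e: "bij_betw e {0..<card S} S" using ex_bij_betw_nat_finite[of S] by auto
  have "enat (card S) \<le> prime_height polynomial_ring (?V (e ` {..<card S}))"
    by (intro prime_chain_le_height[of _ "\<lambda>i. ?V (e ` {..<i})"] primeideal_variable_ideal
        variable_ideal_strict_mono image_psubset[OF bij_betw_imp_inj_on[OF e]])
  also have "e ` {..<card S} = S" using bij_betw_imp_surj_on[OF e] by (simp add: atLeast0LessThan)
  finally show "enat (card S) \<le> prime_height polynomial_ring (?V S)" .
  obtain g where g: "bij_betw g {0..<card (- S)} (- S)"
    using ex_bij_betw_nat_finite[of "- S"] by auto
  let ?t = "card (- S)"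
  have "m \<le> card S"
    if C: "\<forall>i\<le>m. primeideal (C i) polynomial_ring" "\<forall>i<m. C i \<subset> C (Suc i)" "C m = ?V S" for m C
  proof -
    define D where "D i = (if i \<le> m then C i else ?V (S \<union> g ` {..<i - m}))" for i
    have "m + ?t \<le> CARD('x)"
    proof (rule prime_chain_length_le[of _ D])
      show "primeideal (D i) polynomial_ring" if "i \<le> m + ?t" for i
        using C by (auto simp: D_def primeideal_variable_ideal)
      show "D i \<subset> D (Suc i)" if i: "i < m + ?t" for i
      proof (cases "i < m")
        case True
        thus ?thesis using C by (simp add: D_def)
      next
        case False
        let ?j = "i - m"
        have j: "?j < ?t" using i False by simp
        have "g ?j \<in> - S" using bij_betw_imp_surj_on[OF g] j by auto
        hence "S \<union> g ` {..<?j} \<subset> S \<union> g ` {..<Suc ?j}"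
          using image_psubset[OF bij_betw_imp_inj_on[OF g] j] by (auto simp: lessThan_Suc)
        hence "?V (S \<union> g ` {..<?j}) \<subset> ?V (S \<union> g ` {..<Suc ?j})" by (rule variable_ideal_strict_mono)
        moreover have "D i = ?V (S \<union> g ` {..<?j})" using False C(3) by (auto simp: D_def)
        moreover have "D (Suc i) = ?V (S \<union> g ` {..<Suc ?j})" using False by (simp add: D_def Suc_diff_le)
        ultimately show ?thesis by simp
      qed
    qed
    moreover have "card S + ?t = CARD('x)"
      by (metis card_Un_disjoint Compl_disjoint Compl_partition finite)
    ultimately show ?thesis by simp
  qed
  thus "prime_height polynomial_ring (?V S) \<le> enat (card S)"
    unfolding prime_height_def by (intro SUP_least) auto
qed

section \<open>Minimal covers and the primes over a square-free monomial ideal\<close>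

definition covers :: "'a set set \<Rightarrow> 'a set \<Rightarrow> bool" where
  "covers \<B> C \<longleftrightarrow> (\<forall>B\<in>\<B>. B \<inter> C \<noteq> {})"

definition minimal_cover :: "'a set set \<Rightarrow> 'a set \<Rightarrow> bool" where
  "minimal_cover \<B> C \<longleftrightarrow> covers \<B> C \<and> (\<forall>D. D \<subset> C \<longrightarrow> \<not> covers \<B> D)"

lemma minimal_cover_exists:
  assumes "covers \<B> T" "finite T"
  shows "\<exists>C\<subseteq>T. minimal_cover \<B> C"
  using assms(2,1)
proof (induction T rule: finite_psubset_induct)
  case (psubset T)
  show ?case
  proof (cases "minimal_cover \<B> T")
    case False
    then obtain D where "D \<subset> T" "covers \<B> D" using psubset.prems by (auto simp: minimal_cover_def)
    with psubset.IH[of D] show ?thesis by blast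
  qed blast
qed

lemma minimal_cover_witness:
  assumes "minimal_cover \<B> C" "c \<in> C"
  shows "\<exists>B\<in>\<B>. B \<inter> C = {c}"
proof -
  have "\<not> covers \<B> (C - {c})" using assms unfolding minimal_cover_def by blast
  then obtain B where "B \<in> \<B>" "B \<inter> (C - {c}) = {}" by (auto simp: covers_def)
  moreover have "B \<inter> C \<noteq> {}" using \<open>B \<in> \<B>\<close> assms by (auto simp: minimal_cover_def covers_def)
  ultimately show ?thesis by blast
qed

text \<open>Let \<open>u\<close> be the product of the variables outside \<open>C\<close>. Then \<open>r * u\<close> is in the ideal exactly when every
  monomial of \<open>r\<close> has a variable in \<open>C\<close>. It must have one because a generator dividing a monomial of \<open>r * u\<close>
  meets \<open>C\<close>. One such variable \<open>c\<close> is enough because, by minimality of \<open>C\<close>, some generator meets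
  \<open>C\<close> only in \<open>c\<close>.\<close>

lemma minimal_cover_associated_prime:
  fixes G :: "('x::finite \<Rightarrow>\<^sub>0 nat) set"
  assumes sqf: "\<forall>u\<in>G. square_free u"
    and C: "minimal_cover (Poly_Mapping.keys ` G) C"
  shows "(variable_ideal C :: ('x, 'k::field) mpoly set)
    \<in> associated_primes polynomial_ring (ideal_of_monomials G)"
proof -
  let ?I = "ideal_of_monomials G :: ('x, 'k) mpoly set"
  let ?u = "set_exponent (- C)"
  have u: "Poly_Mapping.keys ?u = - C" by (simp add: keys_set_exponent)
  have "r \<in> variable_ideal C \<longleftrightarrow> r * monomial ?u \<in> ?I" for r :: "('x, 'k) mpoly"
  proof
    assume r: "r \<in> variable_ideal C"
    show "r * monomial ?u \<in> ?I"
      unfolding ideal_of_square_free_monomials_iff[OF sqf]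
    proof
      fix w assume "w \<in> Poly_Mapping.keys (r * monomial ?u)"
      with keys_mult[of r "monomial ?u"] obtain a where a: "a \<in> Poly_Mapping.keys r" "w = a + ?u"
        by (auto simp: monomial_def)
      with r obtain c where c: "c \<in> Poly_Mapping.keys a" "c \<in> C" by (auto simp: variable_ideal_iff)
      from minimal_cover_witness[OF C c(2)] obtain v
        where "v \<in> G" "Poly_Mapping.keys v \<inter> C = {c}" by auto
      thus "\<exists>v\<in>G. Poly_Mapping.keys v \<subseteq> Poly_Mapping.keys w"
        using c a(2) by (intro bexI[of _ v]) (auto simp: keys_plus_nat u)
    qed
  next
    assume r: "r * monomial ?u \<in> ?I"
    show "r \<in> variable_ideal C"
      unfolding variable_ideal_iff
    proof
      fix w assume "w \<in> Poly_Mapping.keys r"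
      hence "w + ?u \<in> Poly_Mapping.keys (r * monomial ?u)"
        by (simp add: in_keys_iff lookup_mult_monomial)
      then obtain v where v: "v \<in> G" "Poly_Mapping.keys v \<subseteq> Poly_Mapping.keys (w + ?u)"
        using r unfolding ideal_of_square_free_monomials_iff[OF sqf] by blast
      have "Poly_Mapping.keys v \<inter> C \<noteq> {}" using C v(1) by (auto simp: minimal_cover_def covers_def)
      with v(2) show "Poly_Mapping.keys w \<inter> C \<noteq> {}" by (auto simp: keys_plus_nat u)
    qed
  qed
  hence "variable_ideal C = {r \<in> carrier polynomial_ring. r \<otimes>\<^bsub>polynomial_ring\<^esub> monomial ?u \<in> ?I}"
    by (auto simp: polynomial_ring_simps)
  moreover have "monomial ?u \<in> carrier (polynomial_ring :: ('x, 'k) mpoly ring)"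
    by (simp add: polynomial_ring_simps)
  ultimately show ?thesis
    unfolding associated_primes_def mem_Collect_eq
    by (intro conjI primeideal_variable_ideal bexI)
qed

text \<open>A prime over the ideal contains a product of distinct variables for each generator, hence one of
  its variables. So the variables in the prime form a cover.\<close>

lemma prime_contains_minimal_cover:
  fixes P :: "('x::finite, 'k::field) mpoly set"
  assumes sqf: "\<forall>u\<in>G. square_free u"
    and P: "primeideal P polynomial_ring" and sub: "ideal_of_monomials G \<subseteq> P"
  shows "\<exists>C. minimal_cover (Poly_Mapping.keys ` G) C \<and> variable_ideal C \<subseteq> P"
proof -
  define T where "T = {x. (variable x :: ('x, 'k) mpoly) \<in> P}"
  have some: "\<exists>x\<in>A. variable x \<in> P" if "monomial (set_exponent A) \<in> P" for A
    using finite[of A] that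
  proof (induction A rule: finite_induct)
    case empty
    thus ?case using polynomial_prime_one[OF P] by (simp add: set_exponent_def monomial_def)
  next
    case (insert x A)
    have "monomial (set_exponent (insert x A)) = (variable x * monomial (set_exponent A) :: ('x, 'k) mpoly)"
      using insert.hyps by (simp add: set_exponent_def variable_def monomial_mult)
    with insert show ?case using polynomial_prime_prime[OF P] by (metis insertCI)
  qed
  have "covers (Poly_Mapping.keys ` G) T"
    unfolding covers_def
  proof clarify
    fix u assume u: "u \<in> G" and "Poly_Mapping.keys u \<inter> T = {}"
    moreover have "monomial (set_exponent (Poly_Mapping.keys u)) \<in> P"
      using monomial_in_ideal_of_monomials[OF u] sub by (auto simp: set_exponent_keys bspec[OF sqf u])
    ultimately show False using some by (auto simp: T_def)
  qed
  then obtain C where C: "C \<subseteq> T" "minimal_cover (Poly_Mapping.keys ` G) C"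
    using minimal_cover_exists by (metis finite)
  have "variable_ideal C \<subseteq> P"
    unfolding variable_ideal_def using C(1)
    by (intro ideal_of_monomials_minimal primeideal.axioms(1)[OF P])
       (auto simp: T_def variable_def)
  with C show ?thesis by blast
qed

text \<open>All minimal covers give associated primes, so unmixedness makes their cardinalities equal, and the
  height is this common value since every prime over the ideal lies over one given by a minimal
  cover. A minimal cover exists because the finite height excludes the unit ideal: that ideal lies
  in no prime, and the infimum of the empty set is \<open>\<infinity>\<close>.\<close>

lemma unmixed_minimal_covers:
  fixes G :: "('x::finite \<Rightarrow>\<^sub>0 nat) set"
  defines "I \<equiv> ideal_of_monomials G :: ('x, 'k::field) mpoly set"
  assumes sqf: "\<forall>u\<in>G. square_free u"
    and unm: "unmixed polynomial_ring I" and ht: "ideal_height polynomial_ring I = enat h"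
  shows "\<exists>C. minimal_cover (Poly_Mapping.keys ` G) C"
    and "minimal_cover (Poly_Mapping.keys ` G) C \<Longrightarrow> card C = h"
proof -
  let ?\<B> = "Poly_Mapping.keys ` G"
  have eq: "card C = card D" if "minimal_cover ?\<B> C" "minimal_cover ?\<B> D" for C D
  proof -
    let ?V = "variable_ideal :: 'x set \<Rightarrow> ('x, 'k) mpoly set"
    have "?V C \<in> associated_primes polynomial_ring I" "?V D \<in> associated_primes polynomial_ring I"
      unfolding I_def by (rule minimal_cover_associated_prime[OF sqf], fact)+
    hence "prime_height polynomial_ring (?V C) = prime_height polynomial_ring (?V D)"
      using unm unfolding unmixed_def by blast
    thus ?thesis by (simp add: prime_height_variable_ideal)
  qed
  have "{P. primeideal P polynomial_ring \<and> I \<subseteq> P} \<noteq> {}"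
  proof
    assume "{P. primeideal P polynomial_ring \<and> I \<subseteq> P} = {}"
    hence "ideal_height polynomial_ring I = Inf {}"
      unfolding ideal_height_def by (simp only: image_empty)
    with ht show False by (simp add: top_enat_def)
  qed
  then obtain P where "primeideal P polynomial_ring" "I \<subseteq> P" by blast
  with prime_contains_minimal_cover[of G P] sqf obtain C0 where C0: "minimal_cover ?\<B> C0"
    by (auto simp: I_def)
  thus "\<exists>C. minimal_cover ?\<B> C" ..
  have "ideal_height polynomial_ring I = enat (card C0)"
    unfolding ideal_height_def
  proof (rule antisym)
    have "I \<subseteq> variable_ideal C0"
    proof
      fix p assume "p \<in> I"
      hence p: "\<forall>w\<in>Poly_Mapping.keys p. \<exists>u\<in>G. Poly_Mapping.keys u \<subseteq> Poly_Mapping.keys w"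
        unfolding I_def ideal_of_square_free_monomials_iff[OF sqf] .
      show "p \<in> variable_ideal C0"
        unfolding variable_ideal_iff
      proof
        fix w assume "w \<in> Poly_Mapping.keys p"
        then obtain u where "u \<in> G" "Poly_Mapping.keys u \<subseteq> Poly_Mapping.keys w" using p by blast
        moreover from this(1) have "Poly_Mapping.keys u \<inter> C0 \<noteq> {}"
          using C0 by (simp add: minimal_cover_def covers_def)
        ultimately show "Poly_Mapping.keys w \<inter> C0 \<noteq> {}" by blast
      qed
    qed
    thus "(INF P\<in>{P. primeideal P polynomial_ring \<and> I \<subseteq> P}. prime_height polynomial_ring P)
        \<le> enat (card C0)"
      by (intro INF_lower2[of "variable_ideal C0"])
         (auto simp: primeideal_variable_ideal prime_height_variable_ideal)
    show "enat (card C0) \<le>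
        (INF P\<in>{P. primeideal P polynomial_ring \<and> I \<subseteq> P}. prime_height polynomial_ring P)"
    proof (rule INF_greatest)
      fix P assume "P \<in> {P. primeideal P polynomial_ring \<and> I \<subseteq> P}"
      hence P: "primeideal P polynomial_ring" "I \<subseteq> P" by auto
      then obtain C where C: "minimal_cover ?\<B> C" "variable_ideal C \<subseteq> P"
        using prime_contains_minimal_cover[of G P] sqf by (auto simp: I_def)
      have "enat (card C0) = prime_height polynomial_ring (variable_ideal C :: ('x, 'k) mpoly set)"
        using eq[OF C0 C(1)] by (simp add: prime_height_variable_ideal)
      also have "\<dots> \<le> prime_height polynomial_ring P" by (rule prime_height_mono[OF P(1) C(2)])
      finally show "enat (card C0) \<le> prime_height polynomial_ring P" .
    qed
  qed
  thus "card C = h" if "minimal_cover ?\<B> C" using ht eq[OF that C0] by simp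
qed

section \<open>Fundamental cocircuits of a matroid\<close>

text \<open>Starts the swapping arguments below: among the sets with a given property, take one closest to \<open>T\<close>
  and show that a swap would bring it even closer.\<close>

lemma max_overlap_exists:
  fixes T :: "'a::finite set"
  assumes "P B\<^sub>0"
  shows "\<exists>B. P B \<and> (\<forall>B'. P B' \<longrightarrow> card (B' \<inter> T) \<le> card (B \<inter> T))"
proof (rule ex_has_greatest_nat[of P, OF assms])
  show "\<forall>B. P B \<longrightarrow> card (B \<inter> T) < Suc (card T)"
    by (simp add: less_Suc_eq_le card_mono)
qed

locale matroid_bases =
  fixes \<B> :: "'a::finite set set" and d :: nat
  assumes card_basis: "B \<in> \<B> \<Longrightarrow> card B = d"
    and exchange: "B \<in> \<B> \<Longrightarrow> B' \<in> \<B> \<Longrightarrow> i \<in> B - B' \<Longrightarrow> \<exists>j\<in>B' - B. insert j (B - {i}) \<in> \<B>"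
    and nonempty: "\<B> \<noteq> {}"
begin

text \<open>The complement of the closure of \<open>B - {b}\<close>, written without closures.\<close>

definition fundamental_cocircuit :: "'a set \<Rightarrow> 'a \<Rightarrow> 'a set" where
  "fundamental_cocircuit B b = {x. insert x (B - {b}) \<in> \<B>}"

lemma fundamental_cocircuit_self: "B \<in> \<B> \<Longrightarrow> b \<in> B \<Longrightarrow> b \<in> fundamental_cocircuit B b"
  by (simp add: fundamental_cocircuit_def insert_absorb)

lemma fundamental_cocircuit_Int:
  assumes "B \<in> \<B>" "b \<in> B"
  shows "B \<inter> fundamental_cocircuit B b = {b}"
proof -
  have "x = b" if "x \<in> B" "insert x (B - {b}) \<in> \<B>" for x
  proof (rule ccontr)
    assume "x \<noteq> b"
    hence "insert x (B - {b}) = B - {b}" using that by auto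
    hence "card (B - {b}) = card B" using card_basis assms(1) that(2) by metis
    thus False using assms(2) by (metis card_Diff1_less finite less_irrefl)
  qed
  thus ?thesis
    using fundamental_cocircuit_self[OF assms] assms(2)
    by (auto simp: fundamental_cocircuit_def)
qed

text \<open>A basis without \<open>b\<close> meets the set by the exchange axiom. It is minimal since the basis obtained by
  replacing \<open>b\<close> with \<open>x\<close> meets it in \<open>x\<close> alone.\<close>

lemma fundamental_cocircuit_minimal_cover:
  assumes "B \<in> \<B>" "b \<in> B"
  shows "minimal_cover \<B> (fundamental_cocircuit B b)" (is "minimal_cover _ ?C")
  unfolding minimal_cover_def
proof (intro conjI allI impI)
  show "covers \<B> ?C"
    unfolding covers_def
  proof
    fix B' assume B': "B' \<in> \<B>"
    show "B' \<inter> ?C \<noteq> {}"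
    proof (cases "b \<in> B'")
      case True
      thus ?thesis using fundamental_cocircuit_self[OF assms] by blast
    next
      case False
      then obtain j where "j \<in> B'" "insert j (B - {b}) \<in> \<B>"
        using exchange[OF assms(1) B', of b] assms(2) by blast
      thus ?thesis by (auto simp: fundamental_cocircuit_def)
    qed
  qed
next
  fix D assume "D \<subset> ?C"
  then obtain x where x: "x \<in> ?C" "x \<notin> D" "D \<subseteq> ?C" by blast
  have "insert x (B - {b}) \<inter> D = {}"
    using fundamental_cocircuit_Int[OF assms] x by blast
  moreover have "insert x (B - {b}) \<in> \<B>" using x(1) by (simp add: fundamental_cocircuit_def)
  ultimately show "\<not> covers \<B> D" unfolding covers_def by blast
qed

text \<open>Among the bases containing \<open>x\<close>, take \<open>B'\<close> with the largest intersection with \<open>B\<close>. An element of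
  \<open>B' - B\<close> other than \<open>x\<close> could be exchanged for one of \<open>B\<close>, so \<open>B'\<close> arises from \<open>B\<close> by putting
  \<open>x\<close> in place of a single element.\<close>

lemma fundamental_cocircuits_cover:
  assumes B: "B \<in> \<B>" and B0: "B\<^sub>0 \<in> \<B>" "x \<in> B\<^sub>0"
  shows "\<exists>b\<in>B. x \<in> fundamental_cocircuit B b"
proof (cases "x \<in> B")
  case True
  thus ?thesis using fundamental_cocircuit_self[OF B] by blast
next
  case x: False
  let ?P = "\<lambda>B'. B' \<in> \<B> \<and> x \<in> B'"
  obtain B' where B': "?P B'" "\<And>B''. ?P B'' \<Longrightarrow> card (B'' \<inter> B) \<le> card (B' \<inter> B)"
    using max_overlap_exists[of ?P B\<^sub>0 B] B0 by auto
  have sub: "B' - B \<subseteq> {x}"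
  proof
    fix i assume i: "i \<in> B' - B"
    show "i \<in> {x}"
    proof (rule ccontr)
      assume ix: "i \<notin> {x}"
      obtain j where j: "j \<in> B - B'" "insert j (B' - {i}) \<in> \<B>"
        using exchange[of B' B i] B'(1) B i by blast
      have "insert j (B' - {i}) \<inter> B = insert j (B' \<inter> B)" using i j by blast
      hence "card (insert j (B' - {i}) \<inter> B) = Suc (card (B' \<inter> B))" using j by simp
      moreover have "?P (insert j (B' - {i}))" using j(2) B'(1) ix by blast
      ultimately show False using B'(2)[of "insert j (B' - {i})"] by simp
    qed
  qed
  with B'(1) x have diff: "B' - B = {x}" by blast
  have "card B' = card (B' \<inter> B) + card (B' - B)" by (simp add: card_Int_Diff)
  moreover have "card B = card (B' \<inter> B) + card (B - B')"
    using card_Int_Diff[of B B'] by (simp add: Int_commute)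
  ultimately have "card (B - B') = 1" using card_basis B B'(1) diff by simp
  then obtain b where b: "B - B' = {b}" by (auto simp: card_1_singleton_iff)
  have "insert x (B - {b}) = B'" using diff b by blast
  thus ?thesis using b B'(1) by (intro bexI[of _ b]) (auto simp: fundamental_cocircuit_def)
qed

end

section \<open>Matroids whose cocircuits have equal cardinality\<close>

locale unmixed_matroid = matroid_bases +
  fixes h :: nat
  assumes loopless: "\<Union>\<B> = UNIV"
    and card_cocircuit: "minimal_cover \<B> C \<Longrightarrow> card C = h"
    and rank_pos: "0 < d"
begin

lemma card_fundamental_cocircuit:
  "B \<in> \<B> \<Longrightarrow> b \<in> B \<Longrightarrow> card (fundamental_cocircuit B b) = h"
  by (rule card_cocircuit) (rule fundamental_cocircuit_minimal_cover)

lemma UN_fundamental_cocircuits: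
  assumes "B \<in> \<B>"
  shows "(\<Union>b\<in>B. fundamental_cocircuit B b) = UNIV"
proof -
  have "\<exists>b\<in>B. x \<in> fundamental_cocircuit B b" for x
  proof -
    have "x \<in> \<Union>\<B>" by (simp add: loopless)
    then obtain B\<^sub>0 where "B\<^sub>0 \<in> \<B>" "x \<in> B\<^sub>0" by (rule UnionE)
    thus ?thesis by (rule fundamental_cocircuits_cover[OF assms])
  qed
  thus ?thesis by auto
qed

lemma card_insert_complement:
  assumes "B \<in> \<B>" "b \<in> B"
  shows "card (insert b (- B)) + d = CARD('a) + 1"
proof -
  have "card (insert b (- B)) = Suc (card (- B))" using assms(2) by simp
  moreover have "card B + card (- B) = CARD('a)"
    by (metis card_Un_disjoint Compl_disjoint Compl_partition finite)
  ultimately show ?thesis using card_basis[OF assms(1)] by simp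
qed

lemma fundamental_cocircuit_subset:
  "B \<in> \<B> \<Longrightarrow> b \<in> B \<Longrightarrow> fundamental_cocircuit B b \<subseteq> insert b (- B)"
  using fundamental_cocircuit_Int by blast

lemma basis_nonempty: "B \<in> \<B> \<Longrightarrow> B \<noteq> {}"
  using card_basis rank_pos by force

lemma card_lower: "h + d \<le> CARD('a) + 1"
proof -
  obtain B where B: "B \<in> \<B>" using nonempty by blast
  then obtain b where b: "b \<in> B" using basis_nonempty by blast
  have "h \<le> card (insert b (- B))"
    using card_mono[OF _ fundamental_cocircuit_subset[OF B b]] card_fundamental_cocircuit[OF B b] by simp
  thus ?thesis using card_insert_complement[OF B b] by simp
qed

lemma card_upper: "CARD('a) \<le> h * d"
proof -
  obtain B where B: "B \<in> \<B>" using nonempty by blast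
  have "CARD('a) = card (\<Union>b\<in>B. fundamental_cocircuit B b)"
    by (simp add: UN_fundamental_cocircuits[OF B])
  also have "\<dots> \<le> (\<Sum>b\<in>B. card (fundamental_cocircuit B b))" by (rule card_UN_le) simp
  also have "\<dots> = h * d"
    using card_fundamental_cocircuit[OF B] card_basis[OF B] by simp
  finally show ?thesis .
qed

lemma reach_by_swaps:
  assumes T: "card T = d"
    and swap: "\<And>B. B \<in> \<B> \<Longrightarrow> B \<noteq> T \<Longrightarrow> \<exists>b\<in>B - T. \<exists>t\<in>T - B. insert t (B - {b}) \<in> \<B>"
  shows "T \<in> \<B>"
proof -
  obtain B\<^sub>0 where "B\<^sub>0 \<in> \<B>" using nonempty by blast
  then obtain B where B: "B \<in> \<B>" "\<And>B'. B' \<in> \<B> \<Longrightarrow> card (B' \<inter> T) \<le> card (B \<inter> T)"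
    using max_overlap_exists[of "\<lambda>B. B \<in> \<B>" B\<^sub>0 T] by auto
  have "B = T"
  proof (rule ccontr)
    assume "B \<noteq> T"
    then obtain b t where bt: "b \<in> B - T" "t \<in> T - B" "insert t (B - {b}) \<in> \<B>"
      using swap B(1) by blast
    have "insert t (B - {b}) \<inter> T = insert t (B \<inter> T)" using bt by blast
    hence "card (insert t (B - {b}) \<inter> T) = Suc (card (B \<inter> T))" using bt by simp
    with B(2)[OF bt(3)] show False by simp
  qed
  thus ?thesis using B(1) by simp
qed

lemma uniform_if_card_eq:
  assumes n: "CARD('a) + 1 = h + d" and T: "card T = d"
  shows "T \<in> \<B>"
  using T
proof (rule reach_by_swaps)
  fix B assume B: "B \<in> \<B>" and ne: "B \<noteq> T"
  have "card B = card T" using T card_basis[OF B] by simp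
  hence "\<not> B \<subseteq> T" "\<not> T \<subseteq> B" using ne by (metis card_subset_eq finite)+
  then obtain b t where bt: "b \<in> B - T" "t \<in> T - B" by blast
  have "fundamental_cocircuit B b = insert b (- B)"
    using bt(1) B n card_insert_complement[OF B, of b] card_fundamental_cocircuit[OF B, of b]
    by (intro card_subset_eq fundamental_cocircuit_subset) auto
  hence "insert t (B - {b}) \<in> \<B>" using bt(2) by (auto simp: fundamental_cocircuit_def)
  with bt show "\<exists>b\<in>B - T. \<exists>t\<in>T - B. insert t (B - {b}) \<in> \<B>" by blast
qed

text \<open>If the cardinality were larger, the complement of a cocircuit would have room for a \<open>d\<close>-set, which
  is then a basis missing the cocircuit.\<close>

lemma card_eq_if_uniform:
  assumes uniform: "\<And>T. card T = d \<Longrightarrow> T \<in> \<B>" and C: "minimal_cover \<B> C"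
  shows "CARD('a) + 1 = h + d"
proof (rule ccontr)
  assume "\<not> ?thesis"
  hence "h + d \<le> CARD('a)" using card_lower by simp
  moreover have "card C + card (- C) = CARD('a)"
    by (metis card_Un_disjoint Compl_disjoint Compl_partition finite)
  ultimately have "d \<le> card (- C)" using card_cocircuit[OF C] by simp
  then obtain T where "T \<subseteq> - C" "card T = d" by (meson obtain_subset_with_card_n)
  thus False using uniform[of T] C by (auto simp: minimal_cover_def covers_def)
qed

text \<open>The \<open>d\<close> sets of size \<open>h\<close> cover all \<open>h d\<close> elements, which leaves no room for a common element.\<close>

lemma fundamental_cocircuits_disjoint:
  assumes n: "CARD('a) = h * d" and B: "B \<in> \<B>"
  shows "disjoint_family_on (fundamental_cocircuit B) B"
  unfolding disjoint_family_on_def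
proof (intro ballI impI, rule ccontr)
  let ?F = "fundamental_cocircuit B"
  fix b c assume bc: "b \<in> B" "c \<in> B" "b \<noteq> c" and ne: "?F b \<inter> ?F c \<noteq> {}"
  obtain x where x: "x \<in> ?F b" "x \<in> ?F c" using ne by blast
  have "z \<in> ?F b - {x} \<union> (\<Union>y\<in>B - {b}. ?F y)" for z
  proof -
    have "z \<in> (\<Union>y\<in>B. ?F y)" using UN_fundamental_cocircuits[OF B] by simp
    thus ?thesis using x(2) bc by auto
  qed
  hence "UNIV = ?F b - {x} \<union> (\<Union>y\<in>B - {b}. ?F y)" by blast
  hence "CARD('a) = card (?F b - {x} \<union> (\<Union>y\<in>B - {b}. ?F y))" by simp
  also have "\<dots> \<le> card (?F b - {x}) + card (\<Union>y\<in>B - {b}. ?F y)" by (rule card_Un_le)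
  also have "\<dots> \<le> card (?F b - {x}) + (\<Sum>y\<in>B - {b}. card (?F y))"
    by (intro add_left_mono card_UN_le) simp
  also have "(\<Sum>y\<in>B - {b}. card (?F y)) = h * (d - 1)"
    using card_fundamental_cocircuit[OF B] card_basis[OF B] bc(1) by simp
  also have "card (?F b - {x}) < h"
    using card_fundamental_cocircuit[OF B bc(1)] x(1) by (metis card_Diff1_less finite)
  also have "h + h * (d - 1) = h * d" using rank_pos by (cases d) simp_all
  finally show False using n by simp
qed

lemma basis_meets_block_once:
  assumes n: "CARD('a) = h * d" and B: "B \<in> \<B>" and B': "B' \<in> \<B>" and b: "b \<in> B"
  shows "card (B' \<inter> fundamental_cocircuit B b) = 1"
proof -
  let ?F = "fundamental_cocircuit B"
  have pos: "1 \<le> card (B' \<inter> ?F c)" if "c \<in> B" for c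
    using fundamental_cocircuit_minimal_cover[OF B that] B'
    by (simp add: minimal_cover_def covers_def Suc_le_eq card_gt_0_iff)
  have "(\<Sum>c\<in>B. card (B' \<inter> ?F c)) = card (\<Union>c\<in>B. B' \<inter> ?F c)"
    using fundamental_cocircuits_disjoint[OF n B]
    by (intro card_UN_disjoint[symmetric]) (auto simp: disjoint_family_on_def)
  also have "(\<Union>c\<in>B. B' \<inter> ?F c) = B' \<inter> (\<Union>c\<in>B. ?F c)" by blast
  also have "\<dots> = B'" using UN_fundamental_cocircuits[OF B] by simp
  also have "card B' = (\<Sum>c\<in>B. 1)" using card_basis B B' by simp
  finally have eq: "(\<Sum>c\<in>B. card (B' \<inter> ?F c)) = (\<Sum>c\<in>B. 1)" .
  have "1 = card (B' \<inter> ?F b)"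
    by (rule sum_mono_inv[OF eq[symmetric] pos b]) simp_all
  thus ?thesis by simp
qed

text \<open>Replacing \<open>b'\<close> by \<open>x\<close> in \<open>B'\<close> gives a basis, so it must again meet the block of \<open>b'\<close>, where \<open>b'\<close> was
  the only element of \<open>B'\<close>. Hence \<open>x\<close> is in this block, and the inclusion is an equality because both sides
  have \<open>h\<close> elements.\<close>

lemma fundamental_cocircuit_eq_block:
  assumes n: "CARD('a) = h * d" and B: "B \<in> \<B>" and B': "B' \<in> \<B>"
    and b: "b \<in> B" and b': "b' \<in> B'" "b' \<in> fundamental_cocircuit B b"
  shows "fundamental_cocircuit B' b' = fundamental_cocircuit B b"
proof (rule card_subset_eq)
  let ?F = "fundamental_cocircuit B"
  show "fundamental_cocircuit B' b' \<subseteq> ?F b"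
  proof
    fix x assume "x \<in> fundamental_cocircuit B' b'"
    hence x: "insert x (B' - {b'}) \<in> \<B>" by (simp add: fundamental_cocircuit_def)
    obtain z where z: "B' \<inter> ?F b = {z}"
      using basis_meets_block_once[OF n B B' b] by (rule card_1_singletonE)
    have "b' \<in> {z}" unfolding z[symmetric] using b' by simp
    hence "B' \<inter> ?F b = {b'}" using z by simp
    moreover have "insert x (B' - {b'}) \<inter> ?F b \<noteq> {}"
      using basis_meets_block_once[OF n B x b] by (metis card.empty zero_neq_one)
    ultimately show "x \<in> ?F b" by blast
  qed
  show "card (fundamental_cocircuit B' b') = card (?F b)"
    using card_fundamental_cocircuit[OF B b] card_fundamental_cocircuit[OF B' b'(1)] by simp
qed simp

text \<open>Given a transversal \<open>T\<close> and another basis \<open>B'\<close>, an element of \<open>B' - T\<close> can be replaced by the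
  element of \<open>T\<close> in the same block, because this block is a fundamental cocircuit of \<open>B'\<close> too.\<close>

lemma basis_iff_transversal:
  assumes n: "CARD('a) = h * d" and B: "B \<in> \<B>"
  shows "T \<in> \<B> \<longleftrightarrow> (\<forall>b\<in>B. card (T \<inter> fundamental_cocircuit B b) = 1)"
proof
  assume "T \<in> \<B>"
  thus "\<forall>b\<in>B. card (T \<inter> fundamental_cocircuit B b) = 1"
    using basis_meets_block_once[OF n B] by blast
next
  let ?F = "fundamental_cocircuit B"
  assume T: "\<forall>b\<in>B. card (T \<inter> ?F b) = 1"
  have "T = T \<inter> (\<Union>b\<in>B. ?F b)" using UN_fundamental_cocircuits[OF B] by simp
  also have "\<dots> = (\<Union>b\<in>B. T \<inter> ?F b)" by blast
  finally have "card T = card (\<Union>b\<in>B. T \<inter> ?F b)" by (rule arg_cong)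
  also have "\<dots> = (\<Sum>b\<in>B. card (T \<inter> ?F b))"
    using fundamental_cocircuits_disjoint[OF n B]
    by (intro card_UN_disjoint) (auto simp: disjoint_family_on_def)
  finally have cT: "card T = d" using T card_basis[OF B] by simp
  thus "T \<in> \<B>"
  proof (rule reach_by_swaps)
    fix B' assume B': "B' \<in> \<B>" and ne: "B' \<noteq> T"
    have "card B' = card T" using cT card_basis[OF B'] by simp
    hence "\<not> B' \<subseteq> T" using ne by (metis card_subset_eq finite)
    then obtain b' where b': "b' \<in> B' - T" by blast
    have "b' \<in> (\<Union>b\<in>B. ?F b)" using UN_fundamental_cocircuits[OF B] by simp
    then obtain b where b: "b \<in> B" "b' \<in> ?F b" by blast
    have "card (T \<inter> ?F b) = 1" using T b(1) by blast
    then obtain t where t: "T \<inter> ?F b = {t}" by (rule card_1_singletonE)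
    obtain z where z: "B' \<inter> ?F b = {z}"
      using basis_meets_block_once[OF n B B' b(1)] by (rule card_1_singletonE)
    have "b' \<in> {z}" unfolding z[symmetric] using b' b(2) by simp
    hence "B' \<inter> ?F b = {b'}" using z by simp
    have tT: "t \<in> T" "t \<in> ?F b" using t by auto
    have "t \<notin> B'"
    proof
      assume "t \<in> B'"
      hence "t \<in> {b'}" using tT(2) \<open>B' \<inter> ?F b = {b'}\<close> by blast
      thus False using tT(1) b' by simp
    qed
    moreover have "t \<in> fundamental_cocircuit B' b'"
      unfolding fundamental_cocircuit_eq_block[OF n B B' b(1) DiffD1[OF b'] b(2)] by (rule tT(2))
    ultimately show "\<exists>b\<in>B' - T. \<exists>t\<in>T - B'. insert t (B' - {b}) \<in> \<B>"
      using b' tT(1) unfolding fundamental_cocircuit_def by blast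
  qed
qed

end

section \<open>Minimal generators of products of ideals generated by variables\<close>

lemma is_min_gens_min_gens: "monomial_ideal I \<Longrightarrow> is_min_gens (min_gens I) I"
  unfolding min_gens_def by (rule theI'[OF ex1_min_gens])

lemma ideal_of_min_gens: "monomial_ideal I \<Longrightarrow> ideal_of_monomials (min_gens I) = I"
  by (rule is_min_gens_min_gens[unfolded is_min_gens_def, THEN conjunct1])

lemma min_gens_subset:
  fixes I :: "('x, 'k::field) mpoly set"
  assumes "I = ideal_of_monomials M"
  shows "min_gens I \<subseteq> M"
proof
  fix u assume u: "u \<in> min_gens I"
  have I: "monomial_ideal I" using assms by (auto simp: monomial_ideal_def)
  from is_min_gens_min_gens[OF I]
  have eq: "min_gens I = {u. monomial u \<in> I \<and> (\<forall>v w. u = v + w \<and> monomial v \<in> I \<longrightarrow> v = u)}"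
    by (rule is_min_gens_iff[OF I, THEN iffD1])
  have u': "monomial u \<in> I" "\<forall>v w. u = v + w \<and> monomial v \<in> I \<longrightarrow> v = u"
    using u unfolding eq mem_Collect_eq by iprover+
  from u'(1) obtain v w where v: "v \<in> M" "u = v + w"
    unfolding assms monomial_in_ideal_of_monomials_iff by (elim bexE exE)
  have "monomial v \<in> I" unfolding assms by (rule monomial_in_ideal_of_monomials[OF v(1)])
  hence "v = u" using u'(2) v(2) by iprover
  thus "u \<in> M" using v(1) by (rule subst)
qed

lemma variable_ideal_eq_genideal:
  "variable_ideal S = genideal polynomial_ring (variable ` S)"
  by (simp add: variable_ideal_def ideal_of_monomials_def variable_def image_image)

lemma min_gens_variable_ideal:
  "min_gens (variable_ideal S :: ('x, 'k::field) mpoly set) = (\<lambda>x. Poly_Mapping.single x 1) ` S"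
proof
  let ?I = "variable_ideal S :: ('x, 'k) mpoly set"
  show sub: "min_gens ?I \<subseteq> (\<lambda>x. Poly_Mapping.single x 1) ` S"
    by (rule min_gens_subset[OF variable_ideal_def])
  have gen: "ideal_of_monomials (min_gens ?I) = ?I"
    by (rule ideal_of_min_gens) (auto simp: variable_ideal_def monomial_ideal_def)
  have sqf: "\<forall>u\<in>min_gens ?I. square_free u"
  proof
    fix u assume "u \<in> min_gens ?I"
    then obtain y where "u = Poly_Mapping.single y 1" using sub by blast
    thus "square_free u" using square_free_single by metis
  qed
  show "(\<lambda>x. Poly_Mapping.single x 1) ` S \<subseteq> min_gens ?I"
  proof (rule image_subsetI)
    fix x assume "x \<in> S"
    hence "(variable x :: ('x, 'k) mpoly) \<in> ideal_of_monomials (min_gens ?I)"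
      unfolding gen variable_in_variable_ideal_iff .
    then obtain u where u: "u \<in> min_gens ?I" "Poly_Mapping.keys u \<subseteq> {x}"
      unfolding ideal_of_square_free_monomials_iff[OF sqf]
      by (auto simp: variable_def monomial_def)
    from u(1) sub obtain y where y: "u = Poly_Mapping.single y 1" by blast
    with u(2) have "y = x" by simp
    with y u(1) show "Poly_Mapping.single x 1 \<in> min_gens ?I" by simp
  qed
qed

lemma ideal_support_variable_ideal: "ideal_support (variable_ideal S) = S"
  unfolding ideal_support_def min_gens_variable_ideal by (simp add: image_image)

text \<open>Fixing the intersection sizes, rather than choosing elements, matches the description of the bases
  in \<open>basis_iff_transversal\<close>.\<close>

definition transversals :: "'i set \<Rightarrow> ('i \<Rightarrow> 'x set) \<Rightarrow> 'x set set" where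
  "transversals A S = {T. T \<subseteq> (\<Union>i\<in>A. S i) \<and> (\<forall>i\<in>A. card (T \<inter> S i) = 1)}"

lemma transversals_eq_images:
  assumes "disjoint_family_on S A"
  shows "transversals A S = {x ` A | x. \<forall>i\<in>A. x i \<in> S i}"
proof (intro equalityI subsetI)
  fix T assume T: "T \<in> transversals A S"
  hence "\<forall>i\<in>A. \<exists>y. T \<inter> S i = {y}" by (simp add: transversals_def card_1_singleton_iff)
  then obtain x where x: "\<forall>i\<in>A. T \<inter> S i = {x i}" by metis
  have "x ` A \<subseteq> T" using x by blast
  moreover have "T \<subseteq> x ` A"
  proof
    fix y assume y: "y \<in> T"
    then obtain i where i: "i \<in> A" "y \<in> S i" using T by (auto simp: transversals_def)
    hence "y \<in> T \<inter> S i" using y by simp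
    hence "y = x i" using x i(1) by simp
    thus "y \<in> x ` A" using i(1) by simp
  qed
  ultimately have "T = x ` A" by (rule equalityI[rotated])
  moreover have "\<forall>i\<in>A. x i \<in> S i" using x by blast
  ultimately show "T \<in> {x ` A | x. \<forall>i\<in>A. x i \<in> S i}" by blast
next
  fix T assume "T \<in> {x ` A | x. \<forall>i\<in>A. x i \<in> S i}"
  then obtain x where x: "T = x ` A" "\<forall>i\<in>A. x i \<in> S i" by blast
  have int: "T \<inter> S i = {x i}" if i: "i \<in> A" for i
  proof -
    have "y = x i" if y: "y \<in> T" "y \<in> S i" for y
    proof -
      obtain j where j: "j \<in> A" "y = x j" using y(1) unfolding x(1) by (rule imageE)
      have "j = i"
      proof (rule ccontr)
        assume "j \<noteq> i"
        hence "S j \<inter> S i = {}" by (rule disjoint_family_onD[OF assms j(1) i])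
        thus False using x(2) j y(2) by blast
      qed
      thus ?thesis using j by simp
    qed
    thus ?thesis using x i by auto
  qed
  have "\<forall>i\<in>A. card (T \<inter> S i) = 1"
  proof
    fix i assume "i \<in> A"
    show "card (T \<inter> S i) = 1" unfolding int[OF \<open>i \<in> A\<close>] by simp
  qed
  moreover have "T \<subseteq> (\<Union>i\<in>A. S i)" unfolding x(1) using x(2) by blast
  ultimately show "T \<in> transversals A S"
    unfolding transversals_def mem_Collect_eq by (rule conjI[rotated])
qed

text \<open>A choice of one variable from each of the disjoint sets \<open>S i\<close> is the same as a transversal, and the
  product of the chosen variables is the square-free monomial of the transversal.\<close>

lemma variable_ideal_product:
  fixes J :: "nat \<Rightarrow> ('x, 'k::field) mpoly set"
  assumes disj: "disjoint_family_on S A" and J: "\<And>i. i \<in> A \<Longrightarrow> J i = variable_ideal (S i)"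
  shows "monomial_ideal_product A J = ideal_of_monomials (set_exponent ` transversals A S)"
proof -
  have sum: "set_exponent (x ` A) = (\<Sum>i\<in>A. Poly_Mapping.single (x i) 1)"
    if x: "\<forall>i\<in>A. x i \<in> S i" for x
  proof -
    have "inj_on x A"
    proof (rule inj_onI, rule ccontr)
      fix i j assume ij: "i \<in> A" "j \<in> A" "x i = x j" "i \<noteq> j"
      have "S i \<inter> S j = {}" by (rule disjoint_family_onD[OF disj ij(1,2,4)])
      moreover have "x i \<in> S i" "x i \<in> S j" using x ij(1,2) by (simp, simp add: ij(3))
      ultimately show False by blast
    qed
    thus ?thesis by (simp add: set_exponent_def sum.reindex)
  qed
  have "{\<Prod>i\<in>A. monomial (u i) | u. \<forall>i\<in>A. u i \<in> min_gens (J i)}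
      = {\<Prod>i\<in>A. monomial (Poly_Mapping.single (x i) 1) | x. \<forall>i\<in>A. x i \<in> S i}" (is "?L = ?R")
  proof (intro equalityI subsetI)
    fix p assume "p \<in> ?L"
    then obtain u where u: "p = (\<Prod>i\<in>A. monomial (u i))" "\<forall>i\<in>A. u i \<in> min_gens (J i)" by blast
    have "\<forall>i\<in>A. \<exists>y\<in>S i. u i = Poly_Mapping.single y 1"
    proof
      fix i assume "i \<in> A"
      with u(2) J have "u i \<in> min_gens (variable_ideal (S i) :: ('x, 'k) mpoly set)" by metis
      thus "\<exists>y\<in>S i. u i = Poly_Mapping.single y 1" unfolding min_gens_variable_ideal by blast
    qed
    then obtain x where "\<forall>i\<in>A. x i \<in> S i \<and> u i = Poly_Mapping.single (x i) 1" by metis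
    moreover from this have "p = (\<Prod>i\<in>A. monomial (Poly_Mapping.single (x i) 1))"
      unfolding u(1) by (intro prod.cong) auto
    ultimately show "p \<in> ?R" by blast
  next
    fix p assume "p \<in> ?R"
    then obtain x where x: "p = (\<Prod>i\<in>A. monomial (Poly_Mapping.single (x i) 1))" "\<forall>i\<in>A. x i \<in> S i"
      by blast
    have "\<forall>i\<in>A. Poly_Mapping.single (x i) 1 \<in> min_gens (J i)"
      using x(2) by (simp add: J min_gens_variable_ideal)
    with x(1) show "p \<in> ?L"
      unfolding mem_Collect_eq by (intro exI[of _ "\<lambda>i. Poly_Mapping.single (x i) 1"] conjI)
  qed
  also have "\<dots> = {monomial (set_exponent (x ` A)) | x. \<forall>i\<in>A. x i \<in> S i}"
    unfolding prod_monomial using sum by (metis (no_types, lifting))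
  also have "\<dots> = monomial ` set_exponent ` transversals A S"
    unfolding transversals_eq_images[OF disj] by blast
  finally show ?thesis
    unfolding monomial_ideal_product_def ideal_of_monomials_def by (rule arg_cong)
qed

section \<open>Matroidal ideals\<close>

lemma keys_exchange:
  assumes "square_free u" "i \<in> Poly_Mapping.keys u" "j \<notin> Poly_Mapping.keys u"
  shows "Poly_Mapping.keys (u + Poly_Mapping.single j 1 - Poly_Mapping.single i 1)
    = insert j (Poly_Mapping.keys u - {i})"
proof -
  have "x \<in> Poly_Mapping.keys (u + Poly_Mapping.single j 1 - Poly_Mapping.single i 1)
      \<longleftrightarrow> x \<in> insert j (Poly_Mapping.keys u - {i})" for x
  proof -
    have "Poly_Mapping.lookup (u + Poly_Mapping.single j 1 - Poly_Mapping.single i 1) x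
        = (if x \<in> Poly_Mapping.keys u then 1 else 0) + (if j = x then 1 else 0) - (if i = x then 1 else 0)"
      unfolding lookup_minus lookup_add lookup_single square_free_lookup[OF assms(1)]
      by (simp add: when_def)
    thus ?thesis
      unfolding in_keys_iff[of x "u + Poly_Mapping.single j 1 - Poly_Mapping.single i 1"]
      using assms(2,3) by auto
  qed
  thus ?thesis by blast
qed

lemma matroidal_bases:
  fixes I :: "('x::finite, 'k::field) mpoly set"
  assumes "matroidal_of_degree d I" "min_gens I \<noteq> {}"
  shows "matroid_bases (Poly_Mapping.keys ` min_gens I) d"
proof
  have sqf: "\<forall>u\<in>min_gens I. square_free u" and deg: "\<forall>u\<in>min_gens I. monomial_degree u = d"
    and exch: "\<And>u v i. u \<in> min_gens I \<Longrightarrow> v \<in> min_gens I \<Longrightarrow>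
      Poly_Mapping.lookup u i > Poly_Mapping.lookup v i \<Longrightarrow>
      \<exists>j. Poly_Mapping.lookup u j < Poly_Mapping.lookup v j \<and>
          u + Poly_Mapping.single j 1 - Poly_Mapping.single i 1 \<in> min_gens I"
    using assms(1) unfolding matroidal_of_degree_def matroidal_def by blast+
  show "Poly_Mapping.keys ` min_gens I \<noteq> {}" using assms(2) by simp
  show "card B = d" if "B \<in> Poly_Mapping.keys ` min_gens I" for B
    using that sqf deg by (auto simp flip: square_free_degree)
  show "\<exists>j\<in>B' - B. insert j (B - {i}) \<in> Poly_Mapping.keys ` min_gens I"
    if B: "B \<in> Poly_Mapping.keys ` min_gens I" "B' \<in> Poly_Mapping.keys ` min_gens I" "i \<in> B - B'"
    for B B' i
  proof -
    obtain u v where u: "u \<in> min_gens I" "B = Poly_Mapping.keys u"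
      and v: "v \<in> min_gens I" "B' = Poly_Mapping.keys v" using B(1,2) by blast
    note lookup = square_free_lookup[OF bspec[OF sqf u(1)]] square_free_lookup[OF bspec[OF sqf v(1)]]
    have "Poly_Mapping.lookup u i > Poly_Mapping.lookup v i"
      unfolding lookup using B(3) u(2) v(2) by simp
    then obtain j where j: "Poly_Mapping.lookup u j < Poly_Mapping.lookup v j"
      "u + Poly_Mapping.single j 1 - Poly_Mapping.single i 1 \<in> min_gens I"
      using exch[OF u(1) v(1)] by blast
    have jB: "j \<in> B' - B" using j(1) unfolding lookup u(2) v(2) by (simp split: if_splits)
    have "Poly_Mapping.keys (u + Poly_Mapping.single j 1 - Poly_Mapping.single i 1)
        = insert j (B - {i})"
      unfolding u(2) by (rule keys_exchange[OF bspec[OF sqf u(1)]]) (use B(3) jB u(2) in auto)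
    hence "insert j (B - {i}) \<in> Poly_Mapping.keys ` min_gens I"
      using j(2) by (metis imageI)
    thus ?thesis using jB by blast
  qed
qed

text \<open>A monomial in a matroidal ideal whose degree is \<open>d\<close> is divisible by a generator of the same degree,
  hence equal to it. So equality with the Veronese ideal can be tested on the minimal generators.\<close>

lemma eq_square_free_veronese_iff:
  fixes I :: "('x::finite, 'k::field) mpoly set"
  assumes I: "matroidal_of_degree d I"
  shows "I = square_free_veronese d \<longleftrightarrow>
    (\<forall>T. card T = d \<longrightarrow> T \<in> Poly_Mapping.keys ` min_gens I)"
proof
  have sqf: "\<forall>u\<in>min_gens I. square_free u" and deg: "\<forall>u\<in>min_gens I. monomial_degree u = d"
    and gen: "ideal_of_monomials (min_gens I) = I"
    using I ideal_of_min_gens unfolding matroidal_of_degree_def matroidal_def by iprover+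
  {
    assume eq: "I = square_free_veronese d"
    show "\<forall>T. card T = d \<longrightarrow> T \<in> Poly_Mapping.keys ` min_gens I"
    proof (intro allI impI)
      fix T :: "'x set" assume T: "card T = d"
      have "square_free (set_exponent T) \<and> monomial_degree (set_exponent T) = d"
        using T by (simp add: square_free_set_exponent square_free_degree keys_set_exponent)
      hence "monomial (set_exponent T) \<in> I"
        unfolding eq square_free_veronese_def by (intro monomial_in_ideal_of_monomials) simp
      hence "(monomial (set_exponent T) :: ('x, 'k) mpoly) \<in> ideal_of_monomials (min_gens I)"
        unfolding gen .
      then obtain v where v: "v \<in> min_gens I" "Poly_Mapping.keys v \<subseteq> T"
        unfolding ideal_of_square_free_monomials_iff[OF sqf]
        by (auto simp: monomial_def keys_set_exponent)
      have "card (Poly_Mapping.keys v) = card T"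
        using v(1) T sqf deg by (metis square_free_degree)
      hence "Poly_Mapping.keys v = T" using v(2) by (intro card_subset_eq) simp_all
      thus "T \<in> Poly_Mapping.keys ` min_gens I" using v(1) by blast
    qed
  next
    assume all: "\<forall>T. card T = d \<longrightarrow> T \<in> Poly_Mapping.keys ` min_gens I"
    have "min_gens I = {u. square_free u \<and> monomial_degree u = d}"
    proof (intro equalityI subsetI)
      fix u :: "'x \<Rightarrow>\<^sub>0 nat" assume u: "u \<in> {u. square_free u \<and> monomial_degree u = d}"
      hence "card (Poly_Mapping.keys u) = d" using square_free_degree[of u] by simp
      then obtain v where v: "v \<in> min_gens I" "Poly_Mapping.keys u = Poly_Mapping.keys v"
        using all by blast
      hence "u = v" using u sqf by (intro square_free_eqI) auto
      thus "u \<in> min_gens I" using v(1) by simp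
    qed (use sqf deg in auto)
    thus "I = square_free_veronese d" unfolding square_free_veronese_def using gen by simp
  }
qed

theorem theorem3p6:
  fixes I :: "('x::finite, 'k::field) mpoly set" and n d h :: nat
  assumes "CARD('x) = n" and "n \<ge> 2"
    and "matroidal_of_degree d I"
    and "ideal_support I = UNIV"
    and "unmixed polynomial_ring I"
    and "ideal_height polynomial_ring I = enat h"
  shows "(h + d - 1 \<le> n \<and> n \<le> h * d) \<and>
    (n = h + d - 1 \<longleftrightarrow> I = square_free_veronese d) \<and>
    (n = h * d \<longleftrightarrow>
      (\<exists>J. (\<forall>i\<in>{1..d}. \<exists>S. finite S \<and> card S = h \<and> J i = genideal polynomial_ring (variable ` S)) \<and>
           disjoint_family_on (\<lambda>i. ideal_support (J i)) {1..d} \<and>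
           I = monomial_ideal_product {1..d} J))"
proof -
  define \<B> where "\<B> = Poly_Mapping.keys ` min_gens I"
  have sqf: "\<forall>u\<in>min_gens I. square_free u"
    and gen: "ideal_of_monomials (min_gens I) = I"
    using assms(3) ideal_of_min_gens unfolding matroidal_of_degree_def matroidal_def by iprover+
  have supp: "\<Union>\<B> = UNIV" using assms(4) by (simp add: \<B>_def ideal_support_def)
  have ne: "min_gens I \<noteq> {}" using supp by (auto simp: \<B>_def)
  note covers = unmixed_minimal_covers[OF sqf, folded \<B>_def, where 'k = 'k and h = h, unfolded gen,
      OF assms(5,6)]
  interpret M: matroid_bases \<B> d
    unfolding \<B>_def by (rule matroidal_bases[OF assms(3) ne])
  have d: "0 < d"
  proof (rule ccontr)
    assume "\<not> 0 < d"
    hence "B = {}" if "B \<in> \<B>" for B using M.card_basis[OF that] by simp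
    hence "\<Union>\<B> = {}" by blast
    thus False using supp by simp
  qed
  interpret M: unmixed_matroid \<B> d h
    by unfold_locales (use supp covers(2) d in auto)
  note n = assms(1)
  have uniform: "n = h + d - 1 \<longleftrightarrow> I = square_free_veronese d"
  proof -
    have "n = h + d - 1 \<longleftrightarrow> CARD('x) + 1 = h + d" using n d by auto
    also have "\<dots> \<longleftrightarrow> (\<forall>T. card T = d \<longrightarrow> T \<in> \<B>)"
      using M.uniform_if_card_eq M.card_eq_if_uniform covers(1) by blast
    also have "\<dots> \<longleftrightarrow> I = square_free_veronese d"
      unfolding \<B>_def by (rule eq_square_free_veronese_iff[OF assms(3), symmetric])
    finally show ?thesis .
  qed
  have blocks: "n = h * d \<longleftrightarrow>
      (\<exists>J. (\<forall>i\<in>{1..d}. \<exists>S. finite S \<and> card S = h \<and> J i = genideal polynomial_ring (variable ` S)) \<and>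
           disjoint_family_on (\<lambda>i. ideal_support (J i)) {1..d} \<and>
           I = monomial_ideal_product {1..d} J)" (is "_ \<longleftrightarrow> ?prod")
  proof
    assume "n = h * d"
    hence nhd: "CARD('x) = h * d" using n by simp
    obtain B where B: "B \<in> \<B>" using M.nonempty by blast
    let ?F = "M.fundamental_cocircuit B"
    obtain g where g: "bij_betw g {1..d} B"
      using ex_bij_betw_nat_finite_1[of B] M.card_basis[OF B] by auto
    define S where "S = (\<lambda>i. ?F (g i))"
    define J where "J = (\<lambda>i. variable_ideal (S i) :: ('x, 'k) mpoly set)"
    have img: "g ` {1..d} = B" by (rule bij_betw_imp_surj_on[OF g])
    have disj: "disjoint_family_on S {1..d}"
      unfolding disjoint_family_on_def
    proof (intro ballI impI)
      fix i j assume ij: "i \<in> {1..d}" "j \<in> {1..d}" "i \<noteq> j"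
      hence "g i \<noteq> g j" using inj_onD[OF bij_betw_imp_inj_on[OF g]] by blast
      moreover have "g i \<in> B" "g j \<in> B" using ij(1,2) img by blast+
      ultimately show "S i \<inter> S j = {}"
        unfolding S_def by (intro disjoint_family_onD[OF M.fundamental_cocircuits_disjoint[OF nhd B]])
    qed
    have UN: "(\<Union>i\<in>{1..d}. S i) = UNIV"
      using M.UN_fundamental_cocircuits[OF B] unfolding S_def img[symmetric] by simp
    have ball_img: "(\<forall>b\<in>B. P b) \<longleftrightarrow> (\<forall>i\<in>{1..d}. P (g i))" for P
      using img by blast
    have "transversals {1..d} S = {T. \<forall>b\<in>B. card (T \<inter> ?F b) = 1}"
      unfolding transversals_def UN unfolding S_def ball_img by simp
    also have "\<dots> = \<B>" using M.basis_iff_transversal[OF nhd B] by blast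
    finally have trans: "transversals {1..d} S = \<B>" .
    have exps: "set_exponent ` \<B> = min_gens I"
      unfolding \<B>_def image_image using set_exponent_keys sqf by force
    have "monomial_ideal_product {1..d} J = ideal_of_monomials (set_exponent ` transversals {1..d} S)"
      by (rule variable_ideal_product[OF disj]) (simp add: J_def)
    hence "I = monomial_ideal_product {1..d} J" unfolding trans exps gen by (rule sym)
    moreover have "\<forall>i\<in>{1..d}. \<exists>S. finite S \<and> card S = h \<and> J i = genideal polynomial_ring (variable ` S)"
    proof
      fix i assume "i \<in> {1..d}"
      hence "g i \<in> B" using img by blast
      hence "card (S i) = h" unfolding S_def by (rule M.card_fundamental_cocircuit[OF B])
      thus "\<exists>S. finite S \<and> card S = h \<and> J i = genideal polynomial_ring (variable ` S)"
        by (intro exI[of _ "S i"]) (simp add: J_def variable_ideal_eq_genideal)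
    qed
    moreover have "disjoint_family_on (\<lambda>i. ideal_support (J i)) {1..d}"
      unfolding J_def ideal_support_variable_ideal by (rule disj)
    ultimately show ?prod by blast
  next
    assume ?prod
    then obtain J where
      J: "\<forall>i\<in>{1..d}. \<exists>S. finite S \<and> card S = h \<and> J i = genideal polynomial_ring (variable ` S)"
        "disjoint_family_on (\<lambda>i. ideal_support (J i)) {1..d}" "I = monomial_ideal_product {1..d} J"
      by blast
    from J(1) have "\<forall>i\<in>{1..d}. \<exists>S. card S = h \<and> J i = variable_ideal S"
      unfolding variable_ideal_eq_genideal by blast
    then obtain S where S: "\<forall>i\<in>{1..d}. card (S i) = h \<and> J i = variable_ideal (S i)" by metis
    have disj: "disjoint_family_on S {1..d}"
      using J(2) S unfolding disjoint_family_on_def by (simp add: ideal_support_variable_ideal)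
    have "I = ideal_of_monomials (set_exponent ` transversals {1..d} S)"
      unfolding J(3) using S by (intro variable_ideal_product disj) simp
    hence "min_gens I \<subseteq> set_exponent ` transversals {1..d} S" by (rule min_gens_subset)
    hence "\<B> \<subseteq> Poly_Mapping.keys ` set_exponent ` transversals {1..d} S"
      unfolding \<B>_def by (rule image_mono)
    also have "\<dots> = transversals {1..d} S" by (simp add: image_image keys_set_exponent)
    finally have "\<Union>\<B> \<subseteq> (\<Union>i\<in>{1..d}. S i)" unfolding transversals_def by blast
    hence "(\<Union>i\<in>{1..d}. S i) = UNIV" unfolding supp by (rule top.extremum_uniqueI)
    hence "n = card (\<Union>i\<in>{1..d}. S i)" using n by simp
    also have "\<dots> = (\<Sum>i\<in>{1..d}. card (S i))"
      using disj by (intro card_UN_disjoint) (auto simp: disjoint_family_on_def)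
    also have "\<dots> = h * d" using S by simp
    finally show "n = h * d" .
  qed
  have "h + d - 1 \<le> n" "n \<le> h * d" using M.card_lower M.card_upper n by simp_all
  with uniform blocks show ?thesis by iprover
qed

end
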